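(* Let $\theta=\theta^*:=\dfrac{\sqrt{\alpha_2\lambda_2}}{\sqrt{\alpha_1\lambda_1}+\sqrt{\alpha_2\lambda_2}}$ and let $\boldsymbol{h}^k$ ($k\ge1$) be the error of the time discrete (implicit Euler) Dirichlet--Neumann waveform relaxation iteration. (i) If $\sqrt{\alpha_1/\lambda_1}\,a<\sqrt{\alpha_2/\lambda_2}\,b<2\sqrt{\alpha_1/\lambda_1}\,a$, then $$\|\boldsymbol{h}^k\|_{l^2}\le\left(2\,\frac{\sqrt{\frac{\alpha_2\lambda_1}{\alpha_1\lambda_2}}\frac{b}{a}-1}{\sqrt{\frac{\alpha_2\lambda_2}{\alpha_1\lambda_1}}+1}\right)^k\phi_1(r_{1d}^* )\,\|\boldsymbol{h}^0\|_{l^2},$$ where $$\phi_1(r)=\exp\left(rT-kb\sqrt{\frac{\alpha_2}{\lambda_2}}\sqrt{\frac{1-e^{-r\Delta t}}{\Delta t}}\right),\qquad r_{1d}^*=\frac1{\Delta t}\log\left(\frac{1+\sqrt{\frac{\alpha_2\Delta t}{\lambda_2T^2}b^2k^2+1}}{2}\right).$$ (ii) If $\sqrt{\alpha_2/\lambda_2}\,b\ge2\sqrt{\alpha_1/\lambda_1}\,a$, then $$\|\boldsymbol{h}^k\|_{l^2}\le\left(2\,\frac{\sqrt{\frac{\alpha_2\lambda_1}{\alpha_1\lambda_2}}\frac{b}{a}-1}{\sqrt{\frac{\alpha_2\lambda_2}{\alpha_1\lambda_1}}+1}\right)^k\phi_2(r_{2d}^* )\,\|\boldsymbol{h}^0\|_{l^2},$$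 where $$\phi_2(r)=\exp\left(rT-2ka\sqrt{\frac{\alpha_1}{\lambda_1}}\sqrt{\frac{1-e^{-r\Delta t}}{\Delta t}}\right),\qquad r_{2d}^*=\frac1{\Delta t}\log\left(\frac{1+\sqrt{4\frac{\alpha_1\Delta t}{\lambda_1T^2}a^2k^2+1}}{2}\right).$$
   Context: Let $a,b,T>0$, $\alpha_j,\lambda_j>0$ ($j=1,2$), $N\in\mathbb{N}$, $N\geq 1$, $\Delta t=T/N$. The time discrete DNWR iteration discretizes in time by implicit Euler (space is kept continuous). By linearity, its error is described by the iteration with all sources, initial data and outer boundary data equal to zero: given an arbitrary initial interface error $\boldsymbol{h}^0=(h^{1,0},\dots,h^{N,0})\in\mathbb{R}^N$, for $k=0,1,2,\dots$ and $n=0,\dots,N-1$, with $u_1^{0,k+1}=0$ and $u_2^{0,k+1}=0$, solve the two-point boundary value problems $$\frac{\alpha_1}{\Delta t}\left(u_1^{n+1,k+1}-u_1^{n,k+1}\right)-\lambda_1\partial_{xx}u_1^{n+1,k+1}=0\ \text{in }(-a,0),\quad u_1^{n+1,k+1}(-a)=0,\quad u_1^{n+1,k+1}(0)=h^{n+1,k},$$ $$\frac{\alpha_2}{\Delta t}\left(u_2^{n+1,k+1}-u_2^{n,k+1}\right)-\lambda_2\partial_{xx}u_2^{n+1,k+1}=0\ \text{in }(0,b),\quad -\lambda_2\partial_xu_2^{n+1,k+1}(0)=-\lambda_1\partial_xu_1^{n+1,k+1}(0),\quad u_2^{n+1,k+1}(b)=0,$$ and update $h^{n+1,k+1}=(1-\theta)h^{n+1,k}+\theta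 u_2^{n+1,k+1}(0)$, where $\theta\in(0,1)$ is the relaxation parameter. Write $\boldsymbol{h}^k=(h^{1,k},\dots,h^{N,k})$ and $\|\boldsymbol{h}^k\|_{l^2}^2=\sum_{n=1}^N(h^{n,k})^2$. *)

theory Defs
  imports "HOL-Analysis.Analysis"
begin

text \<open>
  Classical solutions are meant: continuous on the closed interval and twice differentiable in its
  interior, where the differential equation holds.
\<close>

definition implicit_euler_step ::
  "real \<Rightarrow> real \<Rightarrow> real \<Rightarrow> real \<Rightarrow> real \<Rightarrow> (real \<Rightarrow> real) \<Rightarrow> (real \<Rightarrow> real) \<Rightarrow> bool" where
  "implicit_euler_step \<alpha> lam dt l r v u \<longleftrightarrow>
     continuous_on {l..r} u \<and>
     (\<exists>u' u''. \<forall>x\<in>{l<..<r}.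
        (u has_real_derivative u' x) (at x) \<and>
        (u' has_real_derivative u'' x) (at x) \<and>
        \<alpha> / dt * (u x - v x) - lam * u'' x = 0)"

text \<open>
  The superscripts $u_j^{n,k}$ and $h^{n,k}$ are rendered as \<open>u\<^sub>j k n\<close> and \<open>h k n\<close>, so that \<open>h k\<close> is
  the vector of the interface errors at all time steps; only its components \<open>1..N\<close> matter. The
  derivatives in the flux condition are the one-sided derivatives at the interface.
\<close>

definition dnwr_error_iteration ::
  "real \<Rightarrow> real \<Rightarrow> real \<Rightarrow> real \<Rightarrow> real \<Rightarrow> real \<Rightarrow> real \<Rightarrow> nat \<Rightarrow> real \<Rightarrow>
   (nat \<Rightarrow> nat \<Rightarrow> real \<Rightarrow> real) \<Rightarrow> (nat \<Rightarrow> nat \<Rightarrow> real \<Rightarrow> real) \<Rightarrow> (nat \<Rightarrow> nat \<Rightarrow> real) \<Rightarrow> bool" where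
  "dnwr_error_iteration a b \<alpha>\<^sub>1 \<alpha>\<^sub>2 lam\<^sub>1 lam\<^sub>2 dt N \<theta> u\<^sub>1 u\<^sub>2 h \<longleftrightarrow>
     (\<forall>k.
        (\<forall>x\<in>{-a..0}. u\<^sub>1 (Suc k) 0 x = 0) \<and>
        (\<forall>x\<in>{0..b}. u\<^sub>2 (Suc k) 0 x = 0) \<and>
        (\<forall>n<N.
           implicit_euler_step \<alpha>\<^sub>1 lam\<^sub>1 dt (-a) 0 (u\<^sub>1 (Suc k) n) (u\<^sub>1 (Suc k) (Suc n)) \<and>
           u\<^sub>1 (Suc k) (Suc n) (-a) = 0 \<and>
           u\<^sub>1 (Suc k) (Suc n) 0 = h k (Suc n) \<and>
           implicit_euler_step \<alpha>\<^sub>2 lam\<^sub>2 dt 0 b (u\<^sub>2 (Suc k) n) (u\<^sub>2 (Suc k) (Suc n)) \<and>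
           (\<exists>d\<^sub>1 d\<^sub>2.
              (u\<^sub>1 (Suc k) (Suc n) has_real_derivative d\<^sub>1) (at 0 within {-a..0}) \<and>
              (u\<^sub>2 (Suc k) (Suc n) has_real_derivative d\<^sub>2) (at 0 within {0..b}) \<and>
              - lam\<^sub>2 * d\<^sub>2 = - lam\<^sub>1 * d\<^sub>1) \<and>
           u\<^sub>2 (Suc k) (Suc n) b = 0 \<and>
           h (Suc k) (Suc n) = (1 - \<theta>) * h k (Suc n) + \<theta> * u\<^sub>2 (Suc k) (Suc n) 0))"

definition phi1 :: "real \<Rightarrow> real \<Rightarrow> real \<Rightarrow> real \<Rightarrow> real \<Rightarrow> nat \<Rightarrow> real \<Rightarrow> real" where
  "phi1 b T \<alpha>\<^sub>2 lam\<^sub>2 dt k r =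
     exp (r * T - real k * b * sqrt (\<alpha>\<^sub>2 / lam\<^sub>2) * sqrt ((1 - exp (- r * dt)) / dt))"

definition r1d :: "real \<Rightarrow> real \<Rightarrow> real \<Rightarrow> real \<Rightarrow> real \<Rightarrow> nat \<Rightarrow> real" where
  "r1d b T \<alpha>\<^sub>2 lam\<^sub>2 dt k =
     1 / dt * ln ((1 + sqrt (\<alpha>\<^sub>2 * dt / (lam\<^sub>2 * T\<^sup>2) * b\<^sup>2 * (real k)\<^sup>2 + 1)) / 2)"

definition phi2 :: "real \<Rightarrow> real \<Rightarrow> real \<Rightarrow> real \<Rightarrow> real \<Rightarrow> nat \<Rightarrow> real \<Rightarrow> real" where
  "phi2 a T \<alpha>\<^sub>1 lam\<^sub>1 dt k r =
     exp (r * T - 2 * real k * a * sqrt (\<alpha>\<^sub>1 / lam\<^sub>1) * sqrt ((1 - exp (- r * dt)) / dt))"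

definition r2d :: "real \<Rightarrow> real \<Rightarrow> real \<Rightarrow> real \<Rightarrow> real \<Rightarrow> nat \<Rightarrow> real" where
  "r2d a T \<alpha>\<^sub>1 lam\<^sub>1 dt k =
     1 / dt * ln ((1 + sqrt (4 * (\<alpha>\<^sub>1 * dt / (lam\<^sub>1 * T\<^sup>2)) * a\<^sup>2 * (real k)\<^sup>2 + 1)) / 2)"

end

theory Submission
  imports Defs
begin

text \<open>
  A time sequence is encoded as a formal power series in the delay by one time step \<open>X\<close>. In the
  length unit \<open>1 / \<sigma>\<close> with \<open>\<sigma> = sqrt (\<alpha> / (lam * dt))\<close>, implicit Euler turns the heat equation into
  the ordinary differential equation \<open>u'' = (1 - X) u\<close>, whose solutions are combinations of
  \<open>exp (\<plusminus> x sqrt (1 - X))\<close>. Put \<open>A = \<sigma>\<^sub>1 a\<close> and \<open>B = \<sigma>\<^sub>2 b\<close>, and write \<open>sh\<close> and \<open>ch\<close> for the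
  hyperbolic functions with argument multiplied by \<open>sqrt (1 - X)\<close>. Solving both subdomain problems
  shows that an iteration multiplies the interface error by
  \[ (1 - \theta)\Bigl(1 - \frac{sh(B)\,ch(A)}{ch(B)\,sh(A)}\Bigr)
     = -(1 - \theta)\,\frac{sh(B - A)}{sh(A)\,ch(B)}, \]
  because the chosen \<open>\<theta>\<close> makes the factors of both terms equal (\<open>dnwr_error_iteration_kernel\<close>).

  The key fact is that for \<open>A \<le> B\<close> all coefficients of \<open>G = sh (B - A) / (sh A * ch B)\<close> are
  nonnegative (\<open>kernel_bound_iteration_kernel\<close>). The quotients \<open>sh x / sh A\<close> for \<open>0 \<le> x \<le> A\<close> and
  \<open>ch x / ch B\<close> for \<open>\<bar>x\<bar> \<le> B\<close> are responses of the implicit Euler scheme to a unit impulse on the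
  boundary, so their coefficients are nonnegative by the maximum principle, and addition theorems
  write \<open>G\<close> as a sum of products of such quotients.

  For a nonnegative kernel every \<open>q\<close> in \<open>(0, 1)\<close> gives an estimate. With the weights \<open>q ^ n\<close>,
  Young's inequality bounds convolution with \<open>G\<close> on \<open>l\<^sup>2\<close> by the value of \<open>G\<close> at the real point \<open>X = q\<close>.
  No complex frequency has to be considered. The maximum principle also controls the partial sums of
  the kernels by these values, so the convergence of the series is never discussed. For
  \<open>q = exp (- r * dt)\<close>, removing the weights costs the factor \<open>q ^ (- N) = exp (r * T)\<close> once for all
  \<open>k\<close> iterations (\<open>dnwr_error_contraction\<close>). The value of \<open>G\<close> at \<open>q\<close> is an ordinary hyperbolic
  expression in \<open>y = sqrt (1 - q)\<close>. Elementary estimates bound it by \<open>2 (B / A - 1)\<close> times \<open>exp (- B y)\<close>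
  if \<open>B \<le> 2 A\<close> and times \<open>exp (- 2 A y)\<close> if \<open>B \<ge> 2 A\<close>; the \<open>k\<close>-th powers are the exponential
  factors of \<open>phi1\<close> and \<open>phi2\<close>. This works for every \<open>r > 0\<close>; the theorem takes the values \<open>r1d\<close> and \<open>r2d\<close>.
\<close>

unbundle no vec_syntax
unbundle fps_syntax

section \<open>Exponentials and hyperbolic functions of the square root of 1 - X\<close>

definition sqrt_symbol :: "real fps" where
  "sqrt_symbol = fps_radical root 2 (1 - fps_X)"

text \<open>
  The series \<open>exp (t sqrt (1 - X))\<close>. Formal composition needs a zero constant term, so the factor
  \<open>exp t\<close> is split off.
\<close>

definition exp_symbol :: "real \<Rightarrow> real fps" where
  "exp_symbol t = fps_const (exp t) * (fps_exp t oo (sqrt_symbol - 1))"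

definition cosh_symbol :: "real \<Rightarrow> real fps" where
  "cosh_symbol t = fps_const (1/2) * (exp_symbol t + exp_symbol (- t))"

definition sinh_symbol :: "real \<Rightarrow> real fps" where
  "sinh_symbol t = fps_const (1/2) * (exp_symbol t - exp_symbol (- t))"

lemma sqrt_symbol_nth_0 [simp]: "sqrt_symbol $ 0 = 1"
  by (simp add: sqrt_symbol_def numeral_2_eq_2)

lemma sqrt_symbol_squared: "sqrt_symbol * sqrt_symbol = 1 - fps_X"
proof -
  have "fps_radical root (Suc 1) (1 - fps_X :: real fps) ^ Suc 1 = 1 - fps_X"
    using power_radical[of "1 - fps_X :: real fps" root 1] by simp
  then show ?thesis
    by (simp add: sqrt_symbol_def power2_eq_square numeral_2_eq_2)
qed

lemma exp_symbol_add: "exp_symbol (s + t) = exp_symbol s * exp_symbol t"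
  by (simp add: exp_symbol_def exp_add fps_exp_add_mult fps_compose_mult_distrib
      flip: fps_const_mult)

lemma exp_symbol_0 [simp]: "exp_symbol 0 = 1"
  by (simp add: exp_symbol_def)

lemma exp_symbol_nth_0 [simp]: "exp_symbol t $ 0 = exp t"
  by (simp add: exp_symbol_def)

lemma cosh_symbol_nth_0 [simp]: "cosh_symbol t $ 0 = cosh t"
  by (simp add: cosh_symbol_def cosh_def field_simps)

lemma sinh_symbol_nth_0 [simp]: "sinh_symbol t $ 0 = sinh t"
  by (simp add: sinh_symbol_def sinh_def field_simps)

lemma cosh_symbol_0 [simp]: "cosh_symbol 0 = 1"
  by (simp add: cosh_symbol_def numeral_fps_const)

lemma sinh_symbol_0 [simp]: "sinh_symbol 0 = 0"
  by (simp add: sinh_symbol_def)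

lemma cosh_symbol_minus [simp]: "cosh_symbol (- t) = cosh_symbol t"
  by (simp add: cosh_symbol_def add.commute)

lemma sinh_symbol_minus [simp]: "sinh_symbol (- t) = - sinh_symbol t"
  by (simp add: sinh_symbol_def algebra_simps)

lemma sinh_symbol_add:
  "sinh_symbol (s + t) = sinh_symbol s * cosh_symbol t + cosh_symbol s * sinh_symbol t"
proof -
  define c where "c = fps_const (1/2 :: real)"
  have c: "c + c = 1"
    by (simp add: c_def fps_eq_iff)
  have eq: "exp_symbol (- (s + t)) = exp_symbol (- s) * exp_symbol (- t)"
    using exp_symbol_add[of "- s" "- t"] by (simp add: add.commute)
  show ?thesis
    unfolding sinh_symbol_def cosh_symbol_def eq exp_symbol_add c_def[symmetric]
    using c by algebra
qed

lemma sinh_symbol_diff: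
  "sinh_symbol (s - t) = sinh_symbol s * cosh_symbol t - cosh_symbol s * sinh_symbol t"
  using sinh_symbol_add[of s "- t"] by simp

lemma cosh_symbol_inverse [simp]: "inverse (cosh_symbol t) * cosh_symbol t = 1"
  by (rule inverse_mult_eq_1) (simp add: cosh_real_nonzero)

lemma sinh_symbol_inverse [simp]: "t \<noteq> 0 \<Longrightarrow> inverse (sinh_symbol t) * sinh_symbol t = 1"
  by (rule inverse_mult_eq_1) simp

text \<open>
  Differentiation in space of a time sequence, one time step at a time.
\<close>

definition coeffwise_deriv :: "(real \<Rightarrow> real fps) \<Rightarrow> (real \<Rightarrow> real fps) \<Rightarrow> bool" where
  "coeffwise_deriv F F' \<longleftrightarrow>
     (\<forall>n t. ((\<lambda>x. F x $ n) has_real_derivative F' t $ n) (at t))"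

lemma coeffwise_derivD:
  "coeffwise_deriv F F' \<Longrightarrow> ((\<lambda>x. F x $ n) has_real_derivative F' t $ n) (at t within S)"
  unfolding coeffwise_deriv_def by (blast intro: has_field_derivative_at_within)

lemma coeffwise_deriv_mult_left:
  assumes "coeffwise_deriv F F'"
  shows "coeffwise_deriv (\<lambda>x. K * F x) (\<lambda>x. K * F' x)"
  unfolding coeffwise_deriv_def fps_mult_nth
  by (auto intro!: derivative_eq_intros coeffwise_derivD[OF assms] simp: mult.commute)

lemma coeffwise_deriv_add:
  assumes "coeffwise_deriv F F'" "coeffwise_deriv G G'"
  shows "coeffwise_deriv (\<lambda>x. F x + G x) (\<lambda>x. F' x + G' x)"
  unfolding coeffwise_deriv_def
  by (auto intro!: derivative_eq_intros coeffwise_derivD assms)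

lemma coeffwise_deriv_affine:
  assumes "coeffwise_deriv F F'"
  shows "coeffwise_deriv (\<lambda>x. F (m * x + c)) (\<lambda>x. fps_const m * F' (m * x + c))"
  unfolding coeffwise_deriv_def
proof (intro allI)
  fix n t
  have "((\<lambda>x. F x $ n) has_real_derivative F' (m * t + c) $ n) (at (m * t + c))"
    by (rule coeffwise_derivD[OF assms])
  moreover have "((\<lambda>x. m * x + c) has_real_derivative m) (at t)"
    by (auto intro!: derivative_eq_intros)
  ultimately show "((\<lambda>x. F (m * x + c) $ n) has_real_derivative
      (fps_const m * F' (m * t + c)) $ n) (at t)"
    using DERIV_chain2 by (fastforce simp: mult.commute)
qed

text \<open>
  With \<open>g = sqrt (1 - X) - 1\<close>, each coefficient of \<open>exp_symbol t\<close> is \<open>exp t\<close> times a polynomial in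
  \<open>t\<close>, since \<open>g ^ i\<close> has no terms of order below \<open>i\<close>. Differentiating this polynomial shifts the index
  of the exponential sum, which amounts to multiplication of the series by \<open>g\<close>.
\<close>

lemma coeffwise_deriv_exp_symbol:
  "coeffwise_deriv exp_symbol (\<lambda>t. sqrt_symbol * exp_symbol t)"
proof -
  define g where "g = sqrt_symbol - 1"
  have g0: "g $ 0 = 0"
    by (simp add: g_def)
  define C where "C t = fps_exp t oo g" for t :: real
  have C_nth: "C t $ n = (\<Sum>i=0..n. t ^ i / fact i * (g ^ i) $ n)" for t n
    by (simp add: C_def fps_compose_nth)
  \<comment> \<open>The inner sum may run up to \<open>n\<close> because the coefficients of \<open>g ^ i\<close>
      below \<open>i\<close> vanish.\<close>
  have gC_nth: "(g * C t) $ n = (\<Sum>i=0..n. t ^ i / fact i * (g ^ Suc i) $ n)" for t n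
  proof -
    have "(g * C t) $ n = (\<Sum>j=0..n. \<Sum>i=0..n - j. t ^ i / fact i * (g $ j * (g ^ i) $ (n - j)))"
      by (simp add: fps_mult_nth C_nth sum_distrib_left mult_ac)
    also have "\<dots> = (\<Sum>j=0..n. \<Sum>i=0..n. t ^ i / fact i * (g $ j * (g ^ i) $ (n - j)))"
      by (intro sum.cong refl sum.mono_neutral_left) (auto simp: startsby_zero_power_prefix[OF g0])
    also have "\<dots> = (\<Sum>i=0..n. t ^ i / fact i * (\<Sum>j=0..n. g $ j * (g ^ i) $ (n - j)))"
      by (subst sum.swap) (simp add: sum_distrib_left)
    finally show ?thesis
      by (simp add: fps_mult_nth)
  qed
  have C': "((\<lambda>x. C x $ n) has_real_derivative (g * C t) $ n) (at t)" for n t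
  proof -
    have "((\<lambda>x. C x $ n) has_real_derivative
        (\<Sum>i=0..n. (of_nat i * t ^ (i - 1)) / fact i * (g ^ i) $ n)) (at t)"
      unfolding C_nth by (auto intro!: derivative_eq_intros sum.cong simp: mult_ac)
    also have "(\<Sum>i=0..n. (of_nat i * t ^ (i - 1)) / fact i * (g ^ i) $ n) =
        (\<Sum>i=0..<n. t ^ i / fact i * (g ^ Suc i) $ n)"
      by (simp add: sum.atLeast0_atMost_Suc_shift atLeast0AtMost sum.atMost_shift
          atLeast0LessThan field_simps del: power_Suc of_nat_Suc)
    also have "\<dots> = (g * C t) $ n"
      unfolding gC_nth
      by (rule sum.mono_neutral_left) (auto simp: startsby_zero_power_prefix[OF g0] simp del: power_Suc)
    finally show ?thesis .
  qed
  have E: "exp_symbol t $ n = exp t * C t $ n" for t n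
    by (simp add: exp_symbol_def C_def g_def)
  have "((\<lambda>x. exp x * C x $ n) has_real_derivative exp t * C t $ n + exp t * (g * C t) $ n) (at t)" for n t
    by (auto intro!: derivative_eq_intros C')
  moreover have "(sqrt_symbol * exp_symbol t) $ n = exp t * C t $ n + exp t * (g * C t) $ n" for n t
  proof -
    have "sqrt_symbol * exp_symbol t = fps_const (exp t) * ((1 + g) * C t)"
      by (simp add: exp_symbol_def C_def g_def mult_ac)
    then show ?thesis
      by (simp add: distrib_right distrib_left)
  qed
  ultimately show ?thesis
    unfolding coeffwise_deriv_def E by simp
qed

lemma coeffwise_deriv_exp_symbol_minus:
  "coeffwise_deriv (\<lambda>t. exp_symbol (- t)) (\<lambda>t. - (sqrt_symbol * exp_symbol (- t)))"
  using coeffwise_deriv_affine[OF coeffwise_deriv_exp_symbol, of "-1" 0]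
  by (simp add: coeffwise_deriv_def)

lemma coeffwise_deriv_cosh_symbol:
  "coeffwise_deriv cosh_symbol (\<lambda>t. sqrt_symbol * sinh_symbol t)"
proof -
  have "coeffwise_deriv cosh_symbol (\<lambda>t. fps_const (1/2) *
      (sqrt_symbol * exp_symbol t + - (sqrt_symbol * exp_symbol (- t))))"
    unfolding cosh_symbol_def[abs_def]
    by (intro coeffwise_deriv_mult_left coeffwise_deriv_add coeffwise_deriv_exp_symbol
        coeffwise_deriv_exp_symbol_minus)
  then show ?thesis
    by (simp add: sinh_symbol_def right_diff_distrib mult.left_commute)
qed

lemma coeffwise_deriv_sinh_symbol:
  "coeffwise_deriv sinh_symbol (\<lambda>t. sqrt_symbol * cosh_symbol t)"
proof -
  have "coeffwise_deriv (\<lambda>t. fps_const (1/2) * (exp_symbol t + (- 1) * exp_symbol (- t)))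
     (\<lambda>t. fps_const (1/2) *
      (sqrt_symbol * exp_symbol t + (- 1) * - (sqrt_symbol * exp_symbol (- t))))"
    by (intro coeffwise_deriv_mult_left coeffwise_deriv_add coeffwise_deriv_exp_symbol
        coeffwise_deriv_exp_symbol_minus)
  then show ?thesis
    by (simp add: cosh_symbol_def sinh_symbol_def[abs_def] distrib_left mult.left_commute)
qed

section \<open>Nonnegative convolution kernels\<close>

text \<open>
  A power series of this kind stands for convolution with a nonnegative kernel, and \<open>M\<close> bounds its
  value at \<open>q\<close>. Bounding all partial sums expresses this without presupposing convergence, and it
  is the form in which the maximum principle delivers the bound.
\<close>

definition kernel_bound :: "real \<Rightarrow> real fps \<Rightarrow> real \<Rightarrow> bool" where
  "kernel_bound q F M \<longleftrightarrow>
     (\<forall>n. F $ n \<ge> 0) \<and> (\<forall>n. (\<Sum>m\<le>n. F $ m * q ^ m) \<le> M)"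

lemma kernel_bound_0: "M \<ge> 0 \<Longrightarrow> kernel_bound q 0 M"
  by (simp add: kernel_bound_def)

lemma kernel_bound_1: "kernel_bound q 1 1"
proof -
  have "(\<Sum>m\<le>n. (1 :: real fps) $ m * q ^ m) = (\<Sum>m\<le>n. if m = 0 then 1 else 0)" for n
    by (intro sum.cong) auto
  then show ?thesis
    by (simp add: kernel_bound_def)
qed

lemma kernel_bound_add:
  "kernel_bound q F M \<Longrightarrow> kernel_bound q G L \<Longrightarrow> kernel_bound q (F + G) (M + L)"
  by (auto simp: kernel_bound_def distrib_right sum.distrib intro: add_mono)

text \<open>
  A partial sum of the Cauchy product runs over the triangle \<open>i + j \<le> n\<close>. For nonnegative terms it
  is at most the sum over the square, which is the product of two partial sums.
\<close>

lemma kernel_bound_mult: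
  assumes F: "kernel_bound q F M" and G: "kernel_bound q G L" and q: "q \<ge> 0"
  shows "kernel_bound q (F * G) (M * L)"
  unfolding kernel_bound_def
proof (intro conjI allI)
  have F0: "F $ n \<ge> 0" and G0: "G $ n \<ge> 0" for n
    using F G by (auto simp: kernel_bound_def)
  show "(F * G) $ n \<ge> 0" for n
    by (simp add: fps_mult_nth sum_nonneg F0 G0)
  fix n
  have "(\<Sum>m\<le>n. (F * G) $ m * q ^ m) =
      (\<Sum>m\<le>n. \<Sum>i\<le>m. (F $ i * q ^ i) * (G $ (m - i) * q ^ (m - i)))"
    unfolding fps_mult_nth atLeast0AtMost sum_distrib_right
    by (intro sum.cong refl) (auto simp: mult_ac simp flip: power_add)
  also have "\<dots> = (\<Sum>(i, j) \<in> {(i, j). i + j \<le> n}. (F $ i * q ^ i) * (G $ j * q ^ j))"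
    by (rule sum.triangle_reindex_eq[symmetric])
  also have "\<dots> \<le> (\<Sum>(i, j) \<in> {..n} \<times> {..n}. (F $ i * q ^ i) * (G $ j * q ^ j))"
    by (intro sum_mono2) (auto simp: F0 G0 q)
  also have "\<dots> = (\<Sum>i\<le>n. F $ i * q ^ i) * (\<Sum>j\<le>n. G $ j * q ^ j)"
    by (simp add: sum_product sum.cartesian_product)
  also have "\<dots> \<le> M * L"
    using F G by (intro mult_mono) (auto simp: kernel_bound_def q intro!: sum_nonneg
        order_trans[of 0 "\<Sum>m\<le>n. F $ m * q ^ m" M for n])
  finally show "(\<Sum>m\<le>n. (F * G) $ m * q ^ m) \<le> M * L" .
qed

lemma L2_set_sum_le:
  assumes "finite I"
  shows "L2_set (\<lambda>n. \<Sum>m\<in>I. f m n) A \<le> (\<Sum>m\<in>I. L2_set (f m) A)"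
  using assms
proof (induction I)
  case empty
  then show ?case by (simp add: L2_set_0')
next
  case (insert x I)
  then show ?case
    using L2_set_triangle_ineq[of "f x" "\<lambda>n. \<Sum>m\<in>I. f m n" A] by simp
qed

lemma L2_set_shift_le:
  "L2_set (\<lambda>n. if m < n then f (n - m) else 0) {1..N} \<le> L2_set f {1..N::nat}"
proof -
  have "(\<Sum>n\<in>{1..N}. (if m < n then f (n - m) else 0)\<^sup>2) = (\<Sum>n\<in>{m<..N}. (f (n - m))\<^sup>2)"
    by (intro sum.mono_neutral_cong_right) auto
  also have "\<dots> = (\<Sum>i\<in>{1..N - m}. (f i)\<^sup>2)"
    by (rule sum.reindex_bij_witness[of _ "\<lambda>i. i + m" "\<lambda>n. n - m"]) auto
  also have "\<dots> \<le> (\<Sum>i\<in>{1..N}. (f i)\<^sup>2)"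
    by (intro sum_mono2) auto
  finally show ?thesis
    by (simp add: L2_set_def)
qed

text \<open>
  Young's inequality. The weight \<open>q ^ n\<close> is multiplicative, so it passes to both factors of the
  convolution; what remains is the triangle inequality for the shifts of \<open>H\<close>, none of which
  increases the norm. The coefficient at time \<open>0\<close> has to vanish because the norm does not see it.
\<close>

lemma weighted_L2_convolution_le:
  assumes F: "kernel_bound q F M" and q: "q \<ge> 0" and H0: "H $ 0 = 0"
  shows "L2_set (\<lambda>n. q ^ n * (F * H) $ n) {1..N} \<le> M * L2_set (\<lambda>n. q ^ n * H $ n) {1..N}"
proof -
  let ?f = "\<lambda>m. F $ m * q ^ m" and ?g = "\<lambda>n. q ^ n * H $ n"
  have f0: "?f m \<ge> 0" for m
    using F q by (simp add: kernel_bound_def)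
  have conv: "q ^ n * (F * H) $ n = (\<Sum>m\<le>N. ?f m * (if m < n then ?g (n - m) else 0))"
    if "n \<in> {1..N}" for n
  proof -
    have "q ^ n * (F * H) $ n = (\<Sum>m\<le>n. ?f m * ?g (n - m))"
      unfolding fps_mult_nth atLeast0AtMost sum_distrib_left
      by (intro sum.cong refl) (auto simp: mult_ac simp flip: power_add)
    also have "\<dots> = (\<Sum>m\<le>N. ?f m * (if m < n then ?g (n - m) else 0))"
      using that H0 by (intro sum.mono_neutral_cong_left) auto
    finally show ?thesis .
  qed
  have "L2_set (\<lambda>n. q ^ n * (F * H) $ n) {1..N} =
      L2_set (\<lambda>n. \<Sum>m\<le>N. ?f m * (if m < n then ?g (n - m) else 0)) {1..N}"
    by (intro L2_set_cong refl conv)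
  also have "\<dots> \<le> (\<Sum>m\<le>N. L2_set (\<lambda>n. ?f m * (if m < n then ?g (n - m) else 0)) {1..N})"
    by (rule L2_set_sum_le) simp
  also have "\<dots> = (\<Sum>m\<le>N. ?f m * L2_set (\<lambda>n. if m < n then ?g (n - m) else 0) {1..N})"
    by (intro sum.cong refl L2_set_right_distrib[symmetric] f0)
  also have "\<dots> \<le> (\<Sum>m\<le>N. ?f m * L2_set ?g {1..N})"
    using L2_set_shift_le[of _ ?g N] by (intro sum_mono mult_left_mono f0) auto
  also have "\<dots> = (\<Sum>m\<le>N. ?f m) * L2_set ?g {1..N}"
    by (simp add: sum_distrib_right)
  also have "\<dots> \<le> M * L2_set ?g {1..N}"
    using F by (intro mult_right_mono) (auto simp: kernel_bound_def)
  finally show ?thesis .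
qed

section \<open>The maximum principle\<close>

text \<open>
  At a negative interior minimum the second derivative \<open>f - g\<close> would be negative, which is
  impossible.
\<close>

lemma maximum_principle:
  fixes f f' f'' g :: "real \<Rightarrow> real"
  assumes f: "\<And>x. x \<in> {l..r} \<Longrightarrow> (f has_real_derivative f' x) (at x)"
    and f': "\<And>x. x \<in> {l..r} \<Longrightarrow> (f' has_real_derivative f x - g x) (at x)"
    and g: "\<And>x. x \<in> {l..r} \<Longrightarrow> g x \<ge> 0"
    and bdry: "f l \<ge> 0" "f r \<ge> 0"
    and x: "x \<in> {l..r}"
  shows "f x \<ge> 0"
proof (rule ccontr)
  assume neg: "\<not> f x \<ge> 0"
  have "continuous_on {l..r} f"
    by (intro continuous_at_imp_continuous_on ballI DERIV_isCont[OF f])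
  then obtain z where z: "z \<in> {l..r}" and min: "\<And>y. y \<in> {l..r} \<Longrightarrow> f z \<le> f y"
    using continuous_attains_inf[of "{l..r}" f] x by auto
  have fz: "f z < 0"
    using min[OF x] neg by simp
  then have "z \<noteq> l" "z \<noteq> r"
    using bdry by auto
  then have z': "l < z" "z < r"
    using z by auto
  have f'z: "f' z = 0"
  proof (rule DERIV_local_min[OF f[OF z]])
    show "0 < min (z - l) (r - z)"
      using z' by simp
    show "\<forall>y. \<bar>z - y\<bar> < min (z - l) (r - z) \<longrightarrow> f z \<le> f y"
      by (auto intro!: min simp: abs_if split: if_splits)
  qed
  \<comment> \<open>The second derivative at the minimum is negative, so \<open>f\<close> decreases to the right of it.\<close>
  have "f z - g z < 0"
    using fz g[OF z] by simp
  from DERIV_neg_dec_right[OF f'[OF z] this] obtain d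
    where d: "d > 0" "\<And>h. 0 < h \<Longrightarrow> h < d \<Longrightarrow> f' (z + h) < 0"
    using f'z by auto
  define y where "y = z + min (d / 2) (r - z)"
  have y: "z < y" "y \<le> r" "y < z + d"
    using d z' by (auto simp: y_def min_def)
  have "\<exists>c. z < c \<and> c < y \<and> f y - f z = (y - z) * f' c"
    using y z' by (intro MVT2 f) auto
  then obtain c where c: "z < c" "c < y" "f y - f z = (y - z) * f' c"
    by blast
  have "f' c < 0"
    using d(2)[of "c - z"] c y by simp
  then have "f y < f z"
    using c y mult_pos_neg[of "y - z" "f' c"] by simp
  with min[of y] y z' show False
    by simp
qed

text \<open>
  The coefficients of \<open>F\<close> solve the implicit Euler recursion \<open>f\<^sub>n'' = f\<^sub>n - f\<^sub>n\<^sub>-\<^sub>1\<close>, and \<open>w\<close> is the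
  solution of \<open>u'' = (1 - X) u\<close> for the number \<open>X = q\<close>. By induction on \<open>n\<close>, the maximum principle
  carries nonnegativity from the boundary to the interior. It does the same for the defects
  \<open>e\<^sub>n = w - (\<Sum>m\<le>n. f\<^sub>m * q ^ m)\<close>, since they satisfy \<open>e\<^sub>n'' = e\<^sub>n - q * e\<^sub>n\<^sub>-\<^sub>1\<close> with \<open>e\<^sub>-\<^sub>1 = w \<ge> 0\<close>.
\<close>

lemma kernel_bound_interior:
  assumes F: "coeffwise_deriv F F'" and F': "coeffwise_deriv F' (\<lambda>x. (1 - fps_X) * F x)"
    and w: "\<And>x. (w has_real_derivative w' x) (at x)"
    and w': "\<And>x. (w' has_real_derivative (1 - q) * w x) (at x)"
    and w0: "\<And>x. x \<in> {l..r} \<Longrightarrow> w x \<ge> 0"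
    and q: "q \<ge> 0"
    and bdry: "kernel_bound q (F l) (w l)" "kernel_bound q (F r) (w r)"
    and x: "x \<in> {l..r}"
  shows "kernel_bound q (F x) (w x)"
proof -
  have rhs: "((1 - fps_X) * F x) $ n = F x $ n - (if n = 0 then 0 else F x $ (n - 1))" for x n
    by (simp add: left_diff_distrib)
  have coeff: "F x $ n \<ge> 0" if "x \<in> {l..r}" for x n
    using that
  proof (induction n arbitrary: x rule: less_induct)
    case (less n)
    show ?case
    proof (rule maximum_principle[OF _ _ _ _ _ less.prems])
      show "((\<lambda>x. F x $ n) has_real_derivative F' x $ n) (at x)" for x
        by (rule coeffwise_derivD[OF F])
      show "((\<lambda>x. F' x $ n) has_real_derivative
          F x $ n - (if n = 0 then 0 else F x $ (n - 1))) (at x)" for x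
        using coeffwise_derivD[OF F', of n x UNIV] by (simp add: rhs)
    qed (use less.IH bdry in \<open>auto simp: kernel_bound_def\<close>)
  qed
  have partial: "(\<Sum>m\<le>n. F x $ m * q ^ m) \<le> w x" if "x \<in> {l..r}" for x n
    using that
  proof (induction n arbitrary: x)
    case 0
    have "0 \<le> w x - F x $ 0"
    proof (rule maximum_principle[of l r "\<lambda>x. w x - F x $ 0" "\<lambda>x. w' x - F' x $ 0" "\<lambda>x. q * w x"])
      show "((\<lambda>x. w x - F x $ 0) has_real_derivative w' x - F' x $ 0) (at x)" for x
        by (intro DERIV_diff w coeffwise_derivD[OF F])
      have "((\<lambda>x. w' x - F' x $ 0) has_real_derivative
          (1 - q) * w x - ((1 - fps_X) * F x) $ 0) (at x)" for x
        by (intro DERIV_diff w' coeffwise_derivD[OF F'])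
      then show "((\<lambda>x. w' x - F' x $ 0) has_real_derivative w x - F x $ 0 - q * w x) (at x)" for x
        by (simp add: algebra_simps)
      have "(\<Sum>m\<le>0. F l $ m * q ^ m) \<le> w l" "(\<Sum>m\<le>0. F r $ m * q ^ m) \<le> w r"
        using bdry unfolding kernel_bound_def by blast+
      then show "0 \<le> w l - F l $ 0" "0 \<le> w r - F r $ 0"
        by simp_all
    qed (use 0 w0 q in auto)
    then show ?case by simp
  next
    case (Suc n)
    let ?P = "\<lambda>n x. \<Sum>m\<le>n. F x $ m * q ^ m"
    have "0 \<le> w x - ?P (Suc n) x"
    proof (rule maximum_principle[of l r "\<lambda>x. w x - ?P (Suc n) x" "\<lambda>x. w' x - (\<Sum>m\<le>Suc n. F' x $ m * q ^ m)"
          "\<lambda>x. q * (w x - ?P n x)"])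
      show "((\<lambda>x. w x - ?P (Suc n) x) has_real_derivative
          w' x - (\<Sum>m\<le>Suc n. F' x $ m * q ^ m)) (at x)" for x
        by (intro DERIV_diff w DERIV_sum DERIV_cmult_right coeffwise_derivD[OF F])
      have D: "((\<lambda>x. w' x - (\<Sum>m\<le>Suc n. F' x $ m * q ^ m)) has_real_derivative
          (1 - q) * w x - (\<Sum>m\<le>Suc n. ((1 - fps_X) * F x) $ m * q ^ m)) (at x)" for x
        by (intro DERIV_diff w' DERIV_sum DERIV_cmult_right coeffwise_derivD[OF F'])
      have eq: "(\<Sum>m\<le>Suc n. ((1 - fps_X) * F x) $ m * q ^ m) = ?P (Suc n) x - q * ?P n x" for x
      proof -
        have "(\<Sum>m\<le>Suc n. ((1 - fps_X) * F x) $ m * q ^ m) =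
            ?P (Suc n) x - (\<Sum>m\<le>Suc n. (if m = 0 then 0 else F x $ (m - 1)) * q ^ m)"
          by (simp add: rhs left_diff_distrib sum_subtractf del: sum.atMost_Suc)
        also have "(\<Sum>m\<le>Suc n. (if m = 0 then 0 else F x $ (m - 1)) * q ^ m) = q * ?P n x"
          by (simp add: sum.atMost_Suc_shift sum_distrib_left mult_ac del: sum.atMost_Suc)
        finally show ?thesis .
      qed
      have "(1 - q) * w x - (?P (Suc n) x - q * ?P n x) =
          w x - ?P (Suc n) x - q * (w x - ?P n x)" for x
        by (simp add: algebra_simps del: sum.atMost_Suc)
      from D[unfolded eq this]
      show "((\<lambda>x. w' x - (\<Sum>m\<le>Suc n. F' x $ m * q ^ m)) has_real_derivative
          w x - ?P (Suc n) x - q * (w x - ?P n x)) (at x)" for x .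
      show "0 \<le> w l - ?P (Suc n) l" "0 \<le> w r - ?P (Suc n) r"
        using bdry unfolding kernel_bound_def by (simp_all del: sum.atMost_Suc)
    qed (use Suc q in auto)
    then show ?case by simp
  qed
  show ?thesis
    using coeff partial x by (simp add: kernel_bound_def)
qed

section \<open>The kernel of one iteration\<close>

lemma coeffwise_deriv_kernel_sinh:
  "coeffwise_deriv (\<lambda>x. K * sinh_symbol x) (\<lambda>x. K * (sqrt_symbol * cosh_symbol x))"
  "coeffwise_deriv (\<lambda>x. K * (sqrt_symbol * cosh_symbol x)) (\<lambda>x. (1 - fps_X) * (K * sinh_symbol x))"
proof -
  show "coeffwise_deriv (\<lambda>x. K * sinh_symbol x) (\<lambda>x. K * (sqrt_symbol * cosh_symbol x))"
    by (intro coeffwise_deriv_mult_left coeffwise_deriv_sinh_symbol)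
  have "coeffwise_deriv (\<lambda>x. K * (sqrt_symbol * cosh_symbol x))
      (\<lambda>x. K * (sqrt_symbol * (sqrt_symbol * sinh_symbol x)))"
    by (intro coeffwise_deriv_mult_left coeffwise_deriv_cosh_symbol)
  then show "coeffwise_deriv (\<lambda>x. K * (sqrt_symbol * cosh_symbol x))
      (\<lambda>x. (1 - fps_X) * (K * sinh_symbol x))"
    by (simp add: mult_ac flip: sqrt_symbol_squared)
qed

lemma coeffwise_deriv_kernel_cosh:
  "coeffwise_deriv (\<lambda>x. K * cosh_symbol x) (\<lambda>x. K * (sqrt_symbol * sinh_symbol x))"
  "coeffwise_deriv (\<lambda>x. K * (sqrt_symbol * sinh_symbol x)) (\<lambda>x. (1 - fps_X) * (K * cosh_symbol x))"
proof -
  show "coeffwise_deriv (\<lambda>x. K * cosh_symbol x) (\<lambda>x. K * (sqrt_symbol * sinh_symbol x))"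
    by (intro coeffwise_deriv_mult_left coeffwise_deriv_cosh_symbol)
  have "coeffwise_deriv (\<lambda>x. K * (sqrt_symbol * sinh_symbol x))
      (\<lambda>x. K * (sqrt_symbol * (sqrt_symbol * cosh_symbol x)))"
    by (intro coeffwise_deriv_mult_left coeffwise_deriv_sinh_symbol)
  then show "coeffwise_deriv (\<lambda>x. K * (sqrt_symbol * sinh_symbol x))
      (\<lambda>x. (1 - fps_X) * (K * cosh_symbol x))"
    by (simp add: mult_ac flip: sqrt_symbol_squared)
qed

text \<open>
  The response at \<open>x\<close> to a unit impulse at \<open>A\<close>, with zero values kept at \<open>0\<close>.
\<close>

lemma kernel_bound_sinh_quotient:
  assumes y: "y > 0" "y\<^sup>2 = 1 - q" and q: "q \<ge> 0" and x: "0 \<le> x" "x \<le> A" and A: "A > 0"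
  shows "kernel_bound q (inverse (sinh_symbol A) * sinh_symbol x) (sinh (x * y) / sinh (A * y))"
proof (rule kernel_bound_interior[where l = 0 and r = A
      and F = "\<lambda>x. inverse (sinh_symbol A) * sinh_symbol x"
      and F' = "\<lambda>x. inverse (sinh_symbol A) * (sqrt_symbol * cosh_symbol x)"
      and w = "\<lambda>x. sinh (x * y) / sinh (A * y)"
      and w' = "\<lambda>x. y * cosh (x * y) / sinh (A * y)"])
  show "coeffwise_deriv (\<lambda>x. inverse (sinh_symbol A) * sinh_symbol x)
      (\<lambda>x. inverse (sinh_symbol A) * (sqrt_symbol * cosh_symbol x))"
    by (rule coeffwise_deriv_kernel_sinh)
  show "coeffwise_deriv (\<lambda>x. inverse (sinh_symbol A) * (sqrt_symbol * cosh_symbol x))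
      (\<lambda>x. (1 - fps_X) * (inverse (sinh_symbol A) * sinh_symbol x))"
    by (rule coeffwise_deriv_kernel_sinh)
  have nz: "A \<noteq> 0" "y \<noteq> 0"
    using A y by auto
  show "((\<lambda>x. sinh (x * y) / sinh (A * y)) has_real_derivative y * cosh (x * y) / sinh (A * y)) (at x)" for x
    using nz by (auto intro!: derivative_eq_intros)
  show "((\<lambda>x. y * cosh (x * y) / sinh (A * y)) has_real_derivative
      (1 - q) * (sinh (x * y) / sinh (A * y))) (at x)" for x
    unfolding y(2)[symmetric] using nz by (auto intro!: derivative_eq_intros simp: power2_eq_square)
  show "kernel_bound q (inverse (sinh_symbol A) * sinh_symbol A) (sinh (A * y) / sinh (A * y))"
    using nz by (simp add: kernel_bound_1)
qed (use assms in \<open>auto simp: kernel_bound_0\<close>)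

text \<open>
  The response at \<open>x\<close> to simultaneous unit impulses at \<open>- B\<close> and \<open>B\<close>.
\<close>

lemma kernel_bound_cosh_quotient:
  assumes y: "y\<^sup>2 = 1 - q" and q: "q \<ge> 0" and x: "\<bar>x\<bar> \<le> B"
  shows "kernel_bound q (inverse (cosh_symbol B) * cosh_symbol x) (cosh (x * y) / cosh (B * y))"
proof (rule kernel_bound_interior[where l = "- B" and r = B
      and F = "\<lambda>x. inverse (cosh_symbol B) * cosh_symbol x"
      and F' = "\<lambda>x. inverse (cosh_symbol B) * (sqrt_symbol * sinh_symbol x)"
      and w = "\<lambda>x. cosh (x * y) / cosh (B * y)"
      and w' = "\<lambda>x. y * sinh (x * y) / cosh (B * y)"])
  show "coeffwise_deriv (\<lambda>x. inverse (cosh_symbol B) * cosh_symbol x)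
      (\<lambda>x. inverse (cosh_symbol B) * (sqrt_symbol * sinh_symbol x))"
    by (rule coeffwise_deriv_kernel_cosh)
  show "coeffwise_deriv (\<lambda>x. inverse (cosh_symbol B) * (sqrt_symbol * sinh_symbol x))
      (\<lambda>x. (1 - fps_X) * (inverse (cosh_symbol B) * cosh_symbol x))"
    by (rule coeffwise_deriv_kernel_cosh)
  show "((\<lambda>x. cosh (x * y) / cosh (B * y)) has_real_derivative y * sinh (x * y) / cosh (B * y)) (at x)" for x
    by (auto intro!: derivative_eq_intros)
  show "((\<lambda>x. y * sinh (x * y) / cosh (B * y)) has_real_derivative
      (1 - q) * (cosh (x * y) / cosh (B * y))) (at x)" for x
    unfolding y[symmetric] by (auto intro!: derivative_eq_intros simp: power2_eq_square)
qed (use assms in \<open>auto simp: kernel_bound_1 cosh_real_nonzero cosh_real_nonneg\<close>)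

text \<open>
  The maximum principle covers \<open>sh x / sh A\<close> only for \<open>x \<le> A\<close>. A larger \<open>x\<close> is lowered by \<open>2 A\<close> with
  \[ sh(x) = sh(x - 2A) + 2\, ch(x - A)\, sh(A), \]
  where \<open>ch (x - A) / ch B\<close> is a nonnegative kernel because \<open>x - A \<le> B\<close>. If \<open>A < x \<le> 2 A\<close>, this
  would create the negative argument \<open>x - 2 A\<close>, and the step by \<open>A\<close> is taken instead: with
  \<open>d = x - A\<close> in \<open>[0, A]\<close>,
  \[ \frac{sh(x)}{sh(A)\,ch(B)}
     = \frac{ch(d)}{ch(B)} + \frac{sh(d)}{sh(A)}\cdot\frac{ch(A)}{ch(B)}. \]
  The same identities hold for the real bounds.
\<close>

lemma kernel_bound_iteration_kernel:
  assumes y: "y > 0" "y\<^sup>2 = 1 - q" and q: "q \<ge> 0" and A: "A > 0" "A \<le> B"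
    and x: "0 \<le> x" "x \<le> B"
  shows "kernel_bound q (inverse (sinh_symbol A) * inverse (cosh_symbol B) * sinh_symbol x)
    (sinh (x * y) / (sinh (A * y) * cosh (B * y)))"
proof -
  let ?iA = "inverse (sinh_symbol A)" and ?iB = "inverse (cosh_symbol B)"
  have nz: "sinh (A * y) \<noteq> 0" "cosh (B * y) \<noteq> 0"
    using A y by (auto simp: cosh_real_nonzero)
  have iA: "?iA * sinh_symbol A = 1"
    using A by simp
  obtain j where "x / A \<le> real j"
    using real_arch_simple by blast
  then have "x \<le> real j * A"
    using A by (simp add: field_simps)
  then show ?thesis
    using x
  proof (induction j arbitrary: x rule: less_induct)
    case (less j)
    consider "x \<le> A" | "A < x" "x \<le> 2 * A" | "2 * A < x"
      by linarith
    then show ?case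
    proof cases
      case 1
      have "kernel_bound q ((?iA * sinh_symbol x) * (?iB * cosh_symbol 0))
          (sinh (x * y) / sinh (A * y) * (cosh (0 * y) / cosh (B * y)))"
        using less.prems 1 assms
        by (intro kernel_bound_mult kernel_bound_sinh_quotient kernel_bound_cosh_quotient) auto
      then show ?thesis
        by (simp add: mult_ac)
    next
      case 2
      define d where "d = x - A"
      have d: "x = d + A" "0 \<le> d" "d \<le> A"
        using 2 by (auto simp: d_def)
      have "kernel_bound q (?iB * cosh_symbol d + (?iA * sinh_symbol d) * (?iB * cosh_symbol A))
          (cosh (d * y) / cosh (B * y) + sinh (d * y) / sinh (A * y) * (cosh (A * y) / cosh (B * y)))"
        using d assms
        by (intro kernel_bound_add kernel_bound_mult kernel_bound_sinh_quotient
            kernel_bound_cosh_quotient) auto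
      moreover have "?iB * cosh_symbol d + (?iA * sinh_symbol d) * (?iB * cosh_symbol A) =
          ?iA * ?iB * sinh_symbol x"
        unfolding d(1) sinh_symbol_add using iA by algebra
      moreover have "cosh (d * y) / cosh (B * y) + sinh (d * y) / sinh (A * y) * (cosh (A * y) / cosh (B * y)) =
          sinh (x * y) / (sinh (A * y) * cosh (B * y))"
        unfolding d(1) distrib_right sinh_add using nz by (simp add: field_simps)
      ultimately show ?thesis
        by simp
    next
      case 3
      define d where "d = x - A"
      have d: "x = d + A" "0 \<le> d" "x - 2 * A = d - A"
        using 3 A by (auto simp: d_def)
      have "j \<noteq> 0"
        using 3 A less.prems by (cases j) auto
      then have "x - 2 * A \<le> real (j - 1) * A"
        using less.prems A by (simp add: of_nat_diff algebra_simps)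
      then have "kernel_bound q (?iA * ?iB * sinh_symbol (d - A))
          (sinh ((d - A) * y) / (sinh (A * y) * cosh (B * y)))"
        using less.IH[of "j - 1" "x - 2 * A"] \<open>j \<noteq> 0\<close> less.prems 3 A unfolding d(3)[symmetric] by simp
      moreover have "kernel_bound q (?iB * cosh_symbol d) (cosh (d * y) / cosh (B * y))"
        using d less.prems assms by (intro kernel_bound_cosh_quotient) auto
      ultimately have "kernel_bound q (?iA * ?iB * sinh_symbol (d - A) +
            (?iB * cosh_symbol d + ?iB * cosh_symbol d))
          (sinh ((d - A) * y) / (sinh (A * y) * cosh (B * y)) +
            (cosh (d * y) / cosh (B * y) + cosh (d * y) / cosh (B * y)))"
        by (intro kernel_bound_add)
      moreover have "?iA * ?iB * sinh_symbol (d - A) + (?iB * cosh_symbol d + ?iB * cosh_symbol d) =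
          ?iA * ?iB * sinh_symbol x"
        unfolding d(1) sinh_symbol_add sinh_symbol_diff using iA by algebra
      moreover have "sinh ((d - A) * y) / (sinh (A * y) * cosh (B * y)) +
            (cosh (d * y) / cosh (B * y) + cosh (d * y) / cosh (B * y)) =
          sinh (x * y) / (sinh (A * y) * cosh (B * y))"
        unfolding d(1) distrib_right left_diff_distrib sinh_add sinh_diff
        using nz by (simp add: field_simps)
      ultimately show ?thesis
        by simp
    qed
  qed
qed

text \<open>
  Convexity of \<open>sinh\<close> on \<open>[0, \<infinity>)\<close>.
\<close>

lemma sinh_le_mult_sinh:
  fixes R t :: real
  assumes "0 \<le> R" "R \<le> 1" "0 \<le> t"
  shows "sinh (R * t) \<le> R * sinh t"
proof -
  let ?f = "\<lambda>x. R * sinh x - sinh (R * x)"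
  have deriv: "(?f has_real_derivative R * cosh x - R * cosh (R * x)) (at x)" for x
    by (auto intro!: derivative_eq_intros)
  have "R * cosh x - R * cosh (R * x) \<ge> 0" if "0 \<le> x" for x
    using assms that by (auto intro!: mult_left_mono simp: cosh_real_nonneg_le_iff mult_left_le_one_le)
  with deriv have "?f 0 \<le> ?f t"
    by (intro DERIV_nonneg_imp_nondecreasing[OF assms(3), of ?f]) blast
  then show ?thesis
    by simp
qed

text \<open>
  After division by \<open>exp (R * t)\<close> this is \<open>1 - z powr R \<le> R * (1 - z)\<close>, Bernoulli's inequality, at
  \<open>z = exp (- 2 * t)\<close>.
\<close>

lemma sinh_le_exp_mult_sinh:
  fixes R t :: real
  assumes "1 \<le> R" "0 \<le> t"
  shows "sinh (R * t) \<le> R * exp ((R - 1) * t) * sinh t"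
proof -
  let ?f = "\<lambda>x. R * (1 - exp (- 2 * x)) - (1 - exp (- 2 * R * x))"
  have deriv: "(?f has_real_derivative 2 * R * (exp (- 2 * x) - exp (- 2 * R * x))) (at x)" for x
    by (auto intro!: derivative_eq_intros simp: right_diff_distrib)
  have "2 * R * (exp (- 2 * x) - exp (- 2 * R * x)) \<ge> 0" if "0 \<le> x" for x
  proof -
    have "x \<le> R * x"
      using assms that by (simp add: mult_le_cancel_right1)
    then show ?thesis
      using assms by simp
  qed
  with deriv have "?f 0 \<le> ?f t"
    by (intro DERIV_nonneg_imp_nondecreasing[OF assms(2), of ?f]) blast
  then have "1 - exp (- 2 * R * t) \<le> R * (1 - exp (- 2 * t))"
    by simp
  then have "exp (R * t) * (1 - exp (- 2 * R * t)) \<le> exp (R * t) * (R * (1 - exp (- 2 * t)))"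
    by (intro mult_left_mono) auto
  moreover have "exp (R * t) * (1 - exp (- 2 * R * t)) = 2 * sinh (R * t)"
    by (simp add: sinh_def algebra_simps flip: exp_add)
  moreover have "exp (R * t) * (R * (1 - exp (- 2 * t))) = 2 * (R * exp ((R - 1) * t) * sinh t)"
    by (simp add: sinh_def algebra_simps flip: exp_add)
  ultimately show ?thesis
    by linarith
qed

lemma inverse_cosh_le: "1 / cosh t \<le> 2 * exp (- t :: real)"
proof -
  have "exp (- t) * exp t \<le> exp (- t) * (2 * cosh t)"
    by (intro mult_left_mono) (simp_all add: cosh_def)
  then show ?thesis
    by (simp add: divide_le_eq mult_ac flip: exp_add)
qed

text \<open>
  Each of the two estimates combines a bound of \<open>sinh ((B - A) * y) / sinh (A * y)\<close>, where the ratio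
  \<open>B / A - 1\<close> of the arguments decides which of the two bounds for \<open>sinh\<close> applies, with
  \<open>1 / cosh (B * y) \<le> 2 * exp (- B * y)\<close>. For \<open>B \<ge> 2 * A\<close> the first factor grows like
  \<open>exp ((B - 2 * A) * y)\<close>, which leaves only \<open>exp (- 2 * A * y)\<close>.
\<close>

lemma iteration_factor_le_near:
  fixes A B y :: real
  assumes "0 < y" "0 < A" "A \<le> B" "B \<le> 2 * A"
  shows "sinh ((B - A) * y) / (sinh (A * y) * cosh (B * y)) \<le> 2 * (B / A - 1) * exp (- B * y)"
proof -
  have "sinh ((B / A - 1) * (A * y)) \<le> (B / A - 1) * sinh (A * y)"
    using assms by (intro sinh_le_mult_sinh) (auto simp: field_simps)
  also have "(B / A - 1) * (A * y) = (B - A) * y"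
    using assms by (simp add: field_simps)
  finally have "sinh ((B - A) * y) / sinh (A * y) \<le> B / A - 1"
    using assms by (simp add: divide_le_eq)
  then have "sinh ((B - A) * y) / sinh (A * y) * (1 / cosh (B * y)) \<le> (B / A - 1) * (2 * exp (- (B * y)))"
    using assms by (intro mult_mono inverse_cosh_le) (auto simp: field_simps cosh_real_nonneg)
  also have "\<dots> = 2 * (B / A - 1) * exp (- B * y)"
    by simp
  finally show ?thesis
    by simp
qed

lemma iteration_factor_le_far:
  fixes A B y :: real
  assumes "0 < y" "0 < A" "2 * A \<le> B"
  shows "sinh ((B - A) * y) / (sinh (A * y) * cosh (B * y)) \<le> 2 * (B / A - 1) * exp (- 2 * A * y)"
proof -
  have "sinh ((B / A - 1) * (A * y)) \<le> (B / A - 1) * exp ((B / A - 1 - 1) * (A * y)) * sinh (A * y)"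
    using assms by (intro sinh_le_exp_mult_sinh) (auto simp: field_simps)
  also have "(B / A - 1) * (A * y) = (B - A) * y"
    using assms by (simp add: field_simps)
  also have "(B / A - 1 - 1) * (A * y) = (B - 2 * A) * y"
    using assms by (simp add: field_simps)
  finally have "sinh ((B - A) * y) / sinh (A * y) \<le> (B / A - 1) * exp ((B - 2 * A) * y)"
    using assms by (simp add: divide_le_eq)
  then have "sinh ((B - A) * y) / sinh (A * y) * (1 / cosh (B * y)) \<le>
      (B / A - 1) * exp ((B - 2 * A) * y) * (2 * exp (- (B * y)))"
    using assms by (intro mult_mono inverse_cosh_le) (auto simp: field_simps cosh_real_nonneg)
  also have "\<dots> = 2 * (B / A - 1) * (exp ((B - 2 * A) * y) * exp (- (B * y)))"
    by simp
  also have "exp ((B - 2 * A) * y) * exp (- (B * y)) = exp (- 2 * A * y)"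
    by (simp add: algebra_simps flip: exp_add)
  finally show ?thesis
    by simp
qed

section \<open>Implicit Euler steps\<close>

text \<open>
  For \<open>s = \<plusminus> \<sigma>\<close> the quantity \<open>(w' + s * w) * exp (- s * x)\<close> is constant on the open interval, which
  gives the formula there; continuity extends it to the end points, where neither \<open>w'\<close> nor the
  differential equation is available.
\<close>

lemma scaled_modified_helmholtz_solution:
  fixes w w' :: "real \<Rightarrow> real"
  assumes \<sigma>: "\<sigma> > 0" and lr: "l < r" and cont: "continuous_on {l..r} w"
    and w: "\<And>x. x \<in> {l<..<r} \<Longrightarrow> (w has_real_derivative w' x) (at x)"
    and w': "\<And>x. x \<in> {l<..<r} \<Longrightarrow> (w' has_real_derivative \<sigma>\<^sup>2 * w x) (at x)"
  obtains P Q where "\<And>x. x \<in> {l..r} \<Longrightarrow> w x = P * exp (\<sigma> * x) + Q * exp (- \<sigma> * x)"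
proof -
  have const: "\<exists>c. \<forall>x\<in>{l<..<r}. (w' x + s * w x) * exp (- s * x) = c" if "s\<^sup>2 = \<sigma>\<^sup>2" for s
  proof (rule has_field_derivative_zero_constant)
    fix x assume x: "x \<in> {l<..<r}"
    have "((\<lambda>x. (w' x + s * w x) * exp (- s * x)) has_real_derivative
        (\<sigma>\<^sup>2 * w x + s * w' x) * exp (- s * x) + (w' x + s * w x) * (- s * exp (- s * x))) (at x)"
      by (auto intro!: derivative_eq_intros w[OF x] w'[OF x])
    also have "(\<sigma>\<^sup>2 * w x + s * w' x) * exp (- s * x) + (w' x + s * w x) * (- s * exp (- s * x)) = 0"
      unfolding that[symmetric] by (simp add: algebra_simps power2_eq_square)
    finally show "((\<lambda>x. (w' x + s * w x) * exp (- s * x)) has_real_derivative 0)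
        (at x within {l<..<r})"
      by (rule has_field_derivative_at_within)
  qed auto
  from const[of \<sigma>] obtain c where
    c: "\<And>x. x \<in> {l<..<r} \<Longrightarrow> (w' x + \<sigma> * w x) * exp (- \<sigma> * x) = c"
    by auto
  from const[of "- \<sigma>"] obtain d where
    d: "\<And>x. x \<in> {l<..<r} \<Longrightarrow> (w' x - \<sigma> * w x) * exp (\<sigma> * x) = d"
    by auto
  define P Q where "P = c / (2 * \<sigma>)" and "Q = - d / (2 * \<sigma>)"
  define g where "g x = w x - (P * exp (\<sigma> * x) + Q * exp (- \<sigma> * x))" for x
  have g0: "g x = 0" if "x \<in> {l<..<r}" for x
  proof -
    have "c * exp (\<sigma> * x) = w' x + \<sigma> * w x"
      by (simp flip: c[OF that] exp_add)
    moreover have "d * exp (- \<sigma> * x) = w' x - \<sigma> * w x"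
      by (simp flip: d[OF that] exp_add)
    ultimately have "2 * \<sigma> * w x = c * exp (\<sigma> * x) - d * exp (- \<sigma> * x)"
      by simp
    then show ?thesis
      using \<sigma> by (simp add: g_def P_def Q_def field_simps)
  qed
  have clos: "closure {l<..<r} = {l..r}"
    using lr by simp
  have "continuous_on (closure {l<..<r}) g"
    unfolding g_def clos by (intro continuous_intros cont)
  then have "g x = 0" if "x \<in> {l..r}" for x
    using continuous_constant_on_closure[of "{l<..<r}" g 0 x] g0 that clos by auto
  then have "w x = P * exp (\<sigma> * x) + Q * exp (- \<sigma> * x)" if "x \<in> {l..r}" for x
    using that by (simp add: g_def)
  then show ?thesis
    by (rule that)
qed

text \<open>
  If the step starts from a known coefficient of \<open>F\<close>, the difference between its result and the next
  coefficient satisfies the homogeneous equation.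
\<close>

lemma implicit_euler_step_general_solution:
  assumes pos: "\<alpha> > 0" "lam > 0" "dt > 0" "l < r" and \<sigma>: "\<sigma> = sqrt (\<alpha> / (lam * dt))"
    and step: "implicit_euler_step \<alpha> lam dt l r v u"
    and F: "coeffwise_deriv F F'" "coeffwise_deriv F' (\<lambda>x. fps_const (\<sigma>\<^sup>2) * ((1 - fps_X) * F x))"
    and v: "\<And>x. x \<in> {l..r} \<Longrightarrow> v x = F x $ n"
  obtains P Q where
    "\<And>x. x \<in> {l..r} \<Longrightarrow> u x = F x $ Suc n + (P * exp (\<sigma> * x) + Q * exp (- \<sigma> * x))"
proof -
  have \<sigma>_pos: "\<sigma> > 0" and \<sigma>2: "\<sigma>\<^sup>2 = \<alpha> / (lam * dt)"
    using pos by (simp_all add: \<sigma>)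
  from step obtain u' u'' where cont: "continuous_on {l..r} u" and
    u: "\<And>x. x \<in> {l<..<r} \<Longrightarrow> (u has_real_derivative u' x) (at x)" and
    u': "\<And>x. x \<in> {l<..<r} \<Longrightarrow> (u' has_real_derivative u'' x) (at x)" and
    eq: "\<And>x. x \<in> {l<..<r} \<Longrightarrow> \<alpha> / dt * (u x - v x) - lam * u'' x = 0"
    unfolding implicit_euler_step_def by blast
  have u'': "u'' x = \<sigma>\<^sup>2 * (u x - F x $ n)" if "x \<in> {l<..<r}" for x
    using eq[OF that] v[of x] that pos by (simp add: \<sigma>2 field_simps)
  have "continuous_on {l..r} (\<lambda>x. F x $ Suc n)"
    by (intro continuous_at_imp_continuous_on ballI DERIV_isCont[OF coeffwise_derivD[OF F(1)]])
  then have c: "continuous_on {l..r} (\<lambda>x. u x - F x $ Suc n)"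
    by (intro continuous_intros cont)
  have d: "((\<lambda>x. u x - F x $ Suc n) has_real_derivative u' x - F' x $ Suc n) (at x)"
    if "x \<in> {l<..<r}" for x
    by (intro DERIV_diff u that coeffwise_derivD[OF F(1)])
  have d': "((\<lambda>x. u' x - F' x $ Suc n) has_real_derivative \<sigma>\<^sup>2 * (u x - F x $ Suc n)) (at x)"
    if "x \<in> {l<..<r}" for x
  proof -
    have "((\<lambda>x. u' x - F' x $ Suc n) has_real_derivative
        u'' x - (fps_const (\<sigma>\<^sup>2) * ((1 - fps_X) * F x)) $ Suc n) (at x)"
      by (intro DERIV_diff u' that coeffwise_derivD[OF F(2)])
    then show ?thesis
      by (simp add: u''[OF that] left_diff_distrib right_diff_distrib)
  qed
  obtain P Q where
    PQ: "\<And>x. x \<in> {l..r} \<Longrightarrow> u x - F x $ Suc n = P * exp (\<sigma> * x) + Q * exp (- \<sigma> * x)"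
    using scaled_modified_helmholtz_solution[OF \<sigma>_pos \<open>l < r\<close> c d d'] by metis
  have "u x = F x $ Suc n + (P * exp (\<sigma> * x) + Q * exp (- \<sigma> * x))" if "x \<in> {l..r}" for x
    using PQ[OF that] by simp
  then show ?thesis
    by (rule that)
qed

lemma implicit_euler_dirichlet_unique:
  assumes pos: "\<alpha> > 0" "lam > 0" "dt > 0" "l < r" and \<sigma>: "\<sigma> = sqrt (\<alpha> / (lam * dt))"
    and F: "coeffwise_deriv F F'" "coeffwise_deriv F' (\<lambda>x. fps_const (\<sigma>\<^sup>2) * ((1 - fps_X) * F x))"
    and step: "\<And>n. n < N \<Longrightarrow> implicit_euler_step \<alpha> lam dt l r (u n) (u (Suc n))"
    and init: "\<And>x. x \<in> {l..r} \<Longrightarrow> u 0 x = F x $ 0"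
    and left: "\<And>n. n < N \<Longrightarrow> u (Suc n) l = F l $ Suc n"
    and right: "\<And>n. n < N \<Longrightarrow> u (Suc n) r = F r $ Suc n"
    and x: "x \<in> {l..r}" and n: "n \<le> N"
  shows "u n x = F x $ n"
  using n x
proof (induction n arbitrary: x)
  case 0
  then show ?case by (simp add: init)
next
  case (Suc n)
  have n: "n < N"
    using Suc.prems by simp
  obtain P Q where
    PQ: "\<And>x. x \<in> {l..r} \<Longrightarrow> u (Suc n) x = F x $ Suc n + (P * exp (\<sigma> * x) + Q * exp (- \<sigma> * x))"
    using implicit_euler_step_general_solution[OF pos \<sigma> step[OF n] F, of n] Suc.IH n by auto
  have l: "P * exp (\<sigma> * l) + Q * exp (- \<sigma> * l) = 0" and r: "P * exp (\<sigma> * r) + Q * exp (- \<sigma> * r) = 0"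
    using PQ[of l] PQ[of r] left[OF n] right[OF n] \<open>l < r\<close> by auto
  have \<sigma>_pos: "\<sigma> > 0"
    using pos by (simp add: \<sigma>)
  have "sinh (\<sigma> * (r - l)) \<noteq> 0"
    using \<sigma>_pos \<open>l < r\<close> by simp
  moreover have "P * (2 * sinh (\<sigma> * (r - l))) =
      (P * exp (\<sigma> * r) + Q * exp (- \<sigma> * r)) * exp (- \<sigma> * l) -
      (P * exp (\<sigma> * l) + Q * exp (- \<sigma> * l)) * exp (- \<sigma> * r)"
    by (simp add: sinh_def algebra_simps flip: exp_add)
  ultimately have "P = 0"
    unfolding l r by simp
  then have "Q = 0"
    using l by simp
  then show ?case
    using PQ[OF Suc.prems(2)] \<open>P = 0\<close> by simp
qed

lemma real_derivative_unique_Icc: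
  fixes f :: "real \<Rightarrow> real"
  assumes "(f has_real_derivative D) (at x within {l..r})"
    and "(f has_real_derivative E) (at x within {l..r})"
    and "l < r" "x \<in> {l..r}"
  shows "D = E"
proof (rule vector_derivative_unique_within)
  show "at x within {l..r} \<noteq> bot"
    using assms by (simp add: trivial_limit_within)
qed (use assms in \<open>simp_all flip: has_real_derivative_iff_has_vector_derivative\<close>)

lemma implicit_euler_neumann_unique:
  assumes pos: "\<alpha> > 0" "lam > 0" "dt > 0" "l < r" and \<sigma>: "\<sigma> = sqrt (\<alpha> / (lam * dt))"
    and F: "coeffwise_deriv F F'" "coeffwise_deriv F' (\<lambda>x. fps_const (\<sigma>\<^sup>2) * ((1 - fps_X) * F x))"
    and step: "\<And>n. n < N \<Longrightarrow> implicit_euler_step \<alpha> lam dt l r (u n) (u (Suc n))"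
    and init: "\<And>x. x \<in> {l..r} \<Longrightarrow> u 0 x = F x $ 0"
    and left: "\<And>n. n < N \<Longrightarrow> (u (Suc n) has_real_derivative F' l $ Suc n) (at l within {l..r})"
    and right: "\<And>n. n < N \<Longrightarrow> u (Suc n) r = F r $ Suc n"
    and x: "x \<in> {l..r}" and n: "n \<le> N"
  shows "u n x = F x $ n"
  using n x
proof (induction n arbitrary: x)
  case 0
  then show ?case by (simp add: init)
next
  case (Suc n)
  have n: "n < N"
    using Suc.prems by simp
  obtain P Q where
    PQ: "\<And>x. x \<in> {l..r} \<Longrightarrow> u (Suc n) x = F x $ Suc n + (P * exp (\<sigma> * x) + Q * exp (- \<sigma> * x))"
    using implicit_euler_step_general_solution[OF pos \<sigma> step[OF n] F, of n] Suc.IH n by auto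
  have \<sigma>_pos: "\<sigma> > 0"
    using pos by (simp add: \<sigma>)
  have "((\<lambda>x. F x $ Suc n + (P * exp (\<sigma> * x) + Q * exp (- \<sigma> * x))) has_real_derivative
      F' l $ Suc n + (P * (\<sigma> * exp (\<sigma> * l)) + Q * (- \<sigma> * exp (- \<sigma> * l)))) (at l within {l..r})"
    by (auto intro!: derivative_eq_intros coeffwise_derivD[OF F(1)])
  then have "(u (Suc n) has_real_derivative
      F' l $ Suc n + (P * (\<sigma> * exp (\<sigma> * l)) + Q * (- \<sigma> * exp (- \<sigma> * l)))) (at l within {l..r})"
    by (rule has_field_derivative_transform_within[OF _ zero_less_one]) (use PQ \<open>l < r\<close> in auto)
  then have "F' l $ Suc n + (P * (\<sigma> * exp (\<sigma> * l)) + Q * (- \<sigma> * exp (- \<sigma> * l))) = F' l $ Suc n"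
    using left[OF n] \<open>l < r\<close> by (intro real_derivative_unique_Icc[where l = l and r = r and x = l]) auto
  then have "\<sigma> * (P * exp (\<sigma> * l) - Q * exp (- \<sigma> * l)) = 0"
    by (simp add: algebra_simps)
  then have l: "P * exp (\<sigma> * l) - Q * exp (- \<sigma> * l) = 0"
    using \<sigma>_pos by simp
  have r: "P * exp (\<sigma> * r) + Q * exp (- \<sigma> * r) = 0"
    using PQ[of r] right[OF n] \<open>l < r\<close> by auto
  have "cosh (\<sigma> * (r - l)) \<noteq> 0"
    by (simp add: cosh_real_nonzero)
  moreover have "P * (2 * cosh (\<sigma> * (r - l))) =
      (P * exp (\<sigma> * r) + Q * exp (- \<sigma> * r)) * exp (- \<sigma> * l) +
      (P * exp (\<sigma> * l) - Q * exp (- \<sigma> * l)) * exp (- \<sigma> * r)"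
    by (simp add: cosh_def algebra_simps flip: exp_add)
  ultimately have "P = 0"
    unfolding l r by simp
  then have "Q = 0"
    using l by simp
  then show ?case
    using PQ[OF Suc.prems(2)] \<open>P = 0\<close> by simp
qed

section \<open>The iteration in terms of its kernel\<close>

lemma coeffwise_deriv_sinh_profile:
  "coeffwise_deriv (\<lambda>x. K * sinh_symbol (m * x + c))
     (\<lambda>x. fps_const m * (K * (sqrt_symbol * cosh_symbol (m * x + c))))"
  "coeffwise_deriv (\<lambda>x. fps_const m * (K * (sqrt_symbol * cosh_symbol (m * x + c))))
     (\<lambda>x. fps_const (m\<^sup>2) * ((1 - fps_X) * (K * sinh_symbol (m * x + c))))"
proof -
  show "coeffwise_deriv (\<lambda>x. K * sinh_symbol (m * x + c))
     (\<lambda>x. fps_const m * (K * (sqrt_symbol * cosh_symbol (m * x + c))))"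
    by (rule coeffwise_deriv_affine[OF coeffwise_deriv_kernel_sinh(1)])
  have "coeffwise_deriv (\<lambda>x. fps_const m * (K * (sqrt_symbol * cosh_symbol (m * x + c))))
     (\<lambda>x. fps_const m * (fps_const m * ((1 - fps_X) * (K * sinh_symbol (m * x + c)))))"
    by (rule coeffwise_deriv_mult_left[OF coeffwise_deriv_affine[OF coeffwise_deriv_kernel_sinh(2)]])
  moreover have "fps_const m * (fps_const m * f) = fps_const (m\<^sup>2) * f" for f
    by (simp add: power2_eq_square flip: mult.assoc)
  ultimately show "coeffwise_deriv (\<lambda>x. fps_const m * (K * (sqrt_symbol * cosh_symbol (m * x + c))))
     (\<lambda>x. fps_const (m\<^sup>2) * ((1 - fps_X) * (K * sinh_symbol (m * x + c))))"
    by simp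
qed

text \<open>
  The subdomain solutions are \<open>H sh (\<sigma>\<^sub>1 (x + a)) / sh A\<close> and a multiple of \<open>sh (\<sigma>\<^sub>2 (b - x))\<close>, whose
  amplitude is determined by equal fluxes at the interface. Uniqueness identifies the given
  solutions with them, for the first \<open>N\<close> time steps.
\<close>

lemma dnwr_error_iteration_kernel:
  fixes h :: "nat \<Rightarrow> nat \<Rightarrow> real"
  assumes pos: "a > 0" "b > 0" "\<alpha>\<^sub>1 > 0" "\<alpha>\<^sub>2 > 0" "lam\<^sub>1 > 0" "lam\<^sub>2 > 0" "dt > 0"
    and \<theta>: "\<theta> = sqrt (\<alpha>\<^sub>2 * lam\<^sub>2) / (sqrt (\<alpha>\<^sub>1 * lam\<^sub>1) + sqrt (\<alpha>\<^sub>2 * lam\<^sub>2))"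
    and iter: "dnwr_error_iteration a b \<alpha>\<^sub>1 \<alpha>\<^sub>2 lam\<^sub>1 lam\<^sub>2 dt N \<theta> u\<^sub>1 u\<^sub>2 h"
    and A: "A = sqrt (\<alpha>\<^sub>1 / (lam\<^sub>1 * dt)) * a" and B: "B = sqrt (\<alpha>\<^sub>2 / (lam\<^sub>2 * dt)) * b"
    and H: "H = Abs_fps (\<lambda>n. if n = 0 then 0 else h k n)"
    and n: "n \<in> {1..N}"
  shows "h (Suc k) n = - (1 - \<theta>) *
    ((inverse (sinh_symbol A) * inverse (cosh_symbol B) * sinh_symbol (B - A)) * H) $ n"
proof -
  define \<sigma>\<^sub>1 \<sigma>\<^sub>2 where "\<sigma>\<^sub>1 = sqrt (\<alpha>\<^sub>1 / (lam\<^sub>1 * dt))" and "\<sigma>\<^sub>2 = sqrt (\<alpha>\<^sub>2 / (lam\<^sub>2 * dt))"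
  have \<sigma>_pos: "\<sigma>\<^sub>1 > 0" "\<sigma>\<^sub>2 > 0"
    using pos by (simp_all add: \<sigma>\<^sub>1_def \<sigma>\<^sub>2_def)
  have AB: "A = \<sigma>\<^sub>1 * a" "B = \<sigma>\<^sub>2 * b" "A > 0"
    using \<sigma>_pos pos by (simp_all add: A B \<sigma>\<^sub>1_def \<sigma>\<^sub>2_def)
  have H_nth: "H $ 0 = 0" "\<And>n. n > 0 \<Longrightarrow> H $ n = h k n"
    by (simp_all add: H)
  let ?iA = "inverse (sinh_symbol A)" and ?iB = "inverse (cosh_symbol B)"
  have iA: "?iA * sinh_symbol A = 1" and iB: "?iB * cosh_symbol B = 1"
    using AB(3) by simp_all
  \<comment> \<open>The ratio of the flux scales of the subdomains; it equals
      \<open>sqrt (\<alpha>\<^sub>1 * lam\<^sub>1) / sqrt (\<alpha>\<^sub>2 * lam\<^sub>2)\<close>.\<close>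
  define \<kappa> where "\<kappa> = lam\<^sub>1 * \<sigma>\<^sub>1 / (lam\<^sub>2 * \<sigma>\<^sub>2)"
  define K\<^sub>1 where "K\<^sub>1 = H * ?iA"
  \<comment> \<open>The sign is negative because the flux condition equates derivatives up to a positive factor, but
      the profile of the second subdomain decreases in \<open>x\<close> while that of the first
      increases.\<close>
  define K\<^sub>2 where "K\<^sub>2 = - (fps_const \<kappa> * (K\<^sub>1 * cosh_symbol A * ?iB))"
  define F\<^sub>1 where "F\<^sub>1 x = K\<^sub>1 * sinh_symbol (\<sigma>\<^sub>1 * x + A)" for x
  define F\<^sub>1' where "F\<^sub>1' x = fps_const \<sigma>\<^sub>1 * (K\<^sub>1 * (sqrt_symbol * cosh_symbol (\<sigma>\<^sub>1 * x + A)))" for x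
  define F\<^sub>2 where "F\<^sub>2 x = K\<^sub>2 * sinh_symbol (- \<sigma>\<^sub>2 * x + B)" for x
  define F\<^sub>2' where "F\<^sub>2' x = fps_const (- \<sigma>\<^sub>2) * (K\<^sub>2 * (sqrt_symbol * cosh_symbol (- \<sigma>\<^sub>2 * x + B)))" for x
  have F\<^sub>1: "coeffwise_deriv F\<^sub>1 F\<^sub>1'"
    "coeffwise_deriv F\<^sub>1' (\<lambda>x. fps_const (\<sigma>\<^sub>1\<^sup>2) * ((1 - fps_X) * F\<^sub>1 x))"
    using coeffwise_deriv_sinh_profile[where K = K\<^sub>1 and m = \<sigma>\<^sub>1 and c = A]
    by (simp_all add: F\<^sub>1_def[abs_def] F\<^sub>1'_def[abs_def])
  have F\<^sub>2: "coeffwise_deriv F\<^sub>2 F\<^sub>2'"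
    "coeffwise_deriv F\<^sub>2' (\<lambda>x. fps_const (\<sigma>\<^sub>2\<^sup>2) * ((1 - fps_X) * F\<^sub>2 x))"
    using coeffwise_deriv_sinh_profile[where K = K\<^sub>2 and m = "- \<sigma>\<^sub>2" and c = B]
    by (simp_all add: F\<^sub>2_def[abs_def] F\<^sub>2'_def[abs_def])
  have F\<^sub>1_bdry: "F\<^sub>1 (- a) = 0" "F\<^sub>1 0 = H" and F\<^sub>2_bdry: "F\<^sub>2 b = 0"
    using iA by (simp_all add: F\<^sub>1_def F\<^sub>2_def AB K\<^sub>1_def mult.assoc)
  have F_init: "F\<^sub>1 x $ 0 = 0" "F\<^sub>2 x $ 0 = 0" for x
    by (simp_all add: F\<^sub>1_def F\<^sub>2_def K\<^sub>1_def K\<^sub>2_def H_nth)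
  have init: "\<And>x. x \<in> {-a..0} \<Longrightarrow> u\<^sub>1 (Suc k) 0 x = 0" "\<And>x. x \<in> {0..b} \<Longrightarrow> u\<^sub>2 (Suc k) 0 x = 0"
    and step: "\<And>n. n < N \<Longrightarrow> implicit_euler_step \<alpha>\<^sub>1 lam\<^sub>1 dt (-a) 0 (u\<^sub>1 (Suc k) n) (u\<^sub>1 (Suc k) (Suc n))"
      "\<And>n. n < N \<Longrightarrow> implicit_euler_step \<alpha>\<^sub>2 lam\<^sub>2 dt 0 b (u\<^sub>2 (Suc k) n) (u\<^sub>2 (Suc k) (Suc n))"
    and bdry: "\<And>n. n < N \<Longrightarrow> u\<^sub>1 (Suc k) (Suc n) (-a) = 0" "\<And>n. n < N \<Longrightarrow> u\<^sub>1 (Suc k) (Suc n) 0 = h k (Suc n)"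
      "\<And>n. n < N \<Longrightarrow> u\<^sub>2 (Suc k) (Suc n) b = 0"
    and flux: "\<And>n. n < N \<Longrightarrow> \<exists>d\<^sub>1 d\<^sub>2.
              (u\<^sub>1 (Suc k) (Suc n) has_real_derivative d\<^sub>1) (at 0 within {-a..0}) \<and>
              (u\<^sub>2 (Suc k) (Suc n) has_real_derivative d\<^sub>2) (at 0 within {0..b}) \<and>
              - lam\<^sub>2 * d\<^sub>2 = - lam\<^sub>1 * d\<^sub>1"
    and update: "\<And>n. n < N \<Longrightarrow> h (Suc k) (Suc n) = (1 - \<theta>) * h k (Suc n) + \<theta> * u\<^sub>2 (Suc k) (Suc n) 0"
    using iter unfolding dnwr_error_iteration_def by blast+
  have u\<^sub>1: "u\<^sub>1 (Suc k) m x = F\<^sub>1 x $ m" if "m \<le> N" "x \<in> {-a..0}" for m x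
  proof (rule implicit_euler_dirichlet_unique[where u = "u\<^sub>1 (Suc k)" and N = N,
        OF _ _ _ _ \<sigma>\<^sub>1_def F\<^sub>1 step(1)])
  qed (use that pos bdry in \<open>auto simp: init F_init F\<^sub>1_bdry H_nth\<close>)
  have flux_F: "lam\<^sub>2 * F\<^sub>2' 0 $ m = lam\<^sub>1 * F\<^sub>1' 0 $ m" for m
  proof -
    have neg: "fps_const (- \<sigma>\<^sub>2) = - fps_const \<sigma>\<^sub>2"
      by (simp only: fps_const_neg)
    have "F\<^sub>2' 0 = fps_const (- \<sigma>\<^sub>2) * (K\<^sub>2 * (sqrt_symbol * cosh_symbol B))"
      by (simp add: F\<^sub>2'_def)
    also have "\<dots> = fps_const \<sigma>\<^sub>2 * (fps_const \<kappa> * (K\<^sub>1 * (sqrt_symbol * cosh_symbol A)))"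
      unfolding neg K\<^sub>2_def using iB by algebra
    finally have "F\<^sub>2' 0 $ m = (fps_const \<sigma>\<^sub>2 * (fps_const \<kappa> * (K\<^sub>1 * (sqrt_symbol * cosh_symbol A)))) $ m"
      by simp
    then have "F\<^sub>2' 0 $ m = \<sigma>\<^sub>2 * \<kappa> * (K\<^sub>1 * (sqrt_symbol * cosh_symbol A)) $ m"
      by simp
    then show ?thesis
      using pos \<sigma>_pos by (simp add: F\<^sub>1'_def \<kappa>_def)
  qed
  have neumann: "(u\<^sub>2 (Suc k) (Suc m) has_real_derivative F\<^sub>2' 0 $ Suc m) (at 0 within {0..b})"
    if m: "m < N" for m
  proof -
    obtain d\<^sub>1 d\<^sub>2 where d\<^sub>1: "(u\<^sub>1 (Suc k) (Suc m) has_real_derivative d\<^sub>1) (at 0 within {-a..0})"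
      and d\<^sub>2: "(u\<^sub>2 (Suc k) (Suc m) has_real_derivative d\<^sub>2) (at 0 within {0..b})"
      and eq: "lam\<^sub>2 * d\<^sub>2 = lam\<^sub>1 * d\<^sub>1"
      using flux[OF m] by auto
    have "((\<lambda>x. F\<^sub>1 x $ Suc m) has_real_derivative d\<^sub>1) (at 0 within {-a..0})"
      by (rule has_field_derivative_transform_within[OF d\<^sub>1 zero_less_one])
        (use m pos u\<^sub>1[of "Suc m"] in auto)
    then have "d\<^sub>1 = F\<^sub>1' 0 $ Suc m"
      using pos
      by (intro real_derivative_unique_Icc[OF _ coeffwise_derivD[OF F\<^sub>1(1)], where l = "- a" and r = 0]) auto
    then have "lam\<^sub>2 * d\<^sub>2 = lam\<^sub>2 * F\<^sub>2' 0 $ Suc m"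
      using eq flux_F[of "Suc m"] by simp
    then have "d\<^sub>2 = F\<^sub>2' 0 $ Suc m"
      using pos by (metis mult_left_cancel less_irrefl)
    with d\<^sub>2 show ?thesis
      by simp
  qed
  have u\<^sub>2: "u\<^sub>2 (Suc k) m x = F\<^sub>2 x $ m" if "m \<le> N" "x \<in> {0..b}" for m x
  proof (rule implicit_euler_neumann_unique[where u = "u\<^sub>2 (Suc k)" and N = N,
        OF _ _ _ _ \<sigma>\<^sub>2_def F\<^sub>2 step(2)])
  qed (use that pos bdry neumann in \<open>auto simp: init F_init F\<^sub>2_bdry\<close>)
  \<comment> \<open>For this relaxation parameter the two terms of the update get equal weights, and the addition
      theorem combines them into a single \<open>sh\<close>.\<close>
  have \<theta>\<kappa>: "\<theta> * \<kappa> = 1 - \<theta>"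
  proof -
    define s\<^sub>1 s\<^sub>2 where "s\<^sub>1 = sqrt (\<alpha>\<^sub>1 * lam\<^sub>1)" and "s\<^sub>2 = sqrt (\<alpha>\<^sub>2 * lam\<^sub>2)"
    have s: "s\<^sub>1 > 0" "s\<^sub>2 > 0"
      using pos by (simp_all add: s\<^sub>1_def s\<^sub>2_def)
    have "lam\<^sub>1 = sqrt lam\<^sub>1 * sqrt lam\<^sub>1" "lam\<^sub>2 = sqrt lam\<^sub>2 * sqrt lam\<^sub>2"
      using pos by simp_all
    then have "lam\<^sub>1 * \<sigma>\<^sub>1 = s\<^sub>1 / sqrt dt" "lam\<^sub>2 * \<sigma>\<^sub>2 = s\<^sub>2 / sqrt dt"
      using pos by (simp_all add: \<sigma>\<^sub>1_def \<sigma>\<^sub>2_def s\<^sub>1_def s\<^sub>2_def real_sqrt_mult real_sqrt_divide field_simps)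
    then have "\<kappa> = s\<^sub>1 / s\<^sub>2"
      using pos by (simp add: \<kappa>_def)
    then show ?thesis
      unfolding \<theta> s\<^sub>1_def[symmetric] s\<^sub>2_def[symmetric] using s by (simp add: field_simps)
  qed
  obtain m where m: "n = Suc m" "m < N"
    using n by (cases n) auto
  have "h (Suc k) n = (1 - \<theta>) * H $ n + \<theta> * F\<^sub>2 0 $ n"
    using update[OF m(2)] u\<^sub>2[of n 0] m pos H_nth(2)[of n] by simp
  also have "F\<^sub>2 0 $ n = - \<kappa> * (K\<^sub>1 * cosh_symbol A * ?iB * sinh_symbol B) $ n"
  proof -
    have "F\<^sub>2 0 = - (fps_const \<kappa> * (K\<^sub>1 * cosh_symbol A * ?iB * sinh_symbol B))"
      by (simp add: F\<^sub>2_def K\<^sub>2_def mult.assoc)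
    then show ?thesis
      by simp
  qed
  also have "(1 - \<theta>) * H $ n + \<theta> * (- \<kappa> * (K\<^sub>1 * cosh_symbol A * ?iB * sinh_symbol B) $ n) =
      (1 - \<theta>) * H $ n - \<theta> * \<kappa> * (K\<^sub>1 * cosh_symbol A * ?iB * sinh_symbol B) $ n"
    by simp
  also have "\<dots> = - (1 - \<theta>) * (K\<^sub>1 * cosh_symbol A * ?iB * sinh_symbol B - H) $ n"
    unfolding \<theta>\<kappa> by (simp add: algebra_simps)
  also have "K\<^sub>1 * cosh_symbol A * ?iB * sinh_symbol B - H = ?iA * ?iB * sinh_symbol (B - A) * H"
    unfolding K\<^sub>1_def sinh_symbol_diff using iA iB by algebra
  finally show ?thesis .
qed

section \<open>Convergence estimates\<close>

lemma relaxation_le_1: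
  fixes x y \<theta> :: real
  assumes "\<theta> = sqrt y / (sqrt x + sqrt y)" "x > 0" "y > 0"
  shows "\<theta> \<le> 1"
proof -
  have "sqrt x + sqrt y > 0"
    using assms by (intro add_pos_pos) simp_all
  then show ?thesis
    unfolding assms(1) by (subst divide_le_eq_1_pos) (use assms in auto)
qed

text \<open>
  Every iteration contracts the weighted norm by \<open>M\<close>. On \<open>{1..N}\<close> the weights lie between \<open>q ^ N\<close>
  and \<open>1\<close>, so that returning to the plain norm costs \<open>q ^ (- N)\<close> once, independently of \<open>k\<close>.
\<close>

lemma dnwr_error_contraction:
  fixes h :: "nat \<Rightarrow> nat \<Rightarrow> real"
  assumes pos: "a > 0" "b > 0" "\<alpha>\<^sub>1 > 0" "\<alpha>\<^sub>2 > 0" "lam\<^sub>1 > 0" "lam\<^sub>2 > 0" "dt > 0"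
    and \<theta>: "\<theta> = sqrt (\<alpha>\<^sub>2 * lam\<^sub>2) / (sqrt (\<alpha>\<^sub>1 * lam\<^sub>1) + sqrt (\<alpha>\<^sub>2 * lam\<^sub>2))"
    and iter: "dnwr_error_iteration a b \<alpha>\<^sub>1 \<alpha>\<^sub>2 lam\<^sub>1 lam\<^sub>2 dt N \<theta> u\<^sub>1 u\<^sub>2 h"
    and A: "A = sqrt (\<alpha>\<^sub>1 / (lam\<^sub>1 * dt)) * a" and B: "B = sqrt (\<alpha>\<^sub>2 / (lam\<^sub>2 * dt)) * b"
    and AB: "A \<le> B" and r: "r > 0"
    and M: "(1 - \<theta>) * (sinh ((B - A) * y) / (sinh (A * y) * cosh (B * y))) \<le> M"
    and y: "y = sqrt (1 - exp (- r * dt))"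
  shows "L2_set (h k) {1..N} \<le> M ^ k * exp (r * (real N * dt)) * L2_set (h 0) {1..N}"
proof -
  define q where "q = exp (- r * dt)"
  have q: "0 < q" "q < 1"
    using r pos by (simp_all add: q_def)
  have y': "y > 0" "y\<^sup>2 = 1 - q"
    using q unfolding y q_def[symmetric] by simp_all
  have A_pos: "A > 0"
    using pos by (simp add: A)
  have \<theta>1: "1 - \<theta> \<ge> 0"
    using relaxation_le_1[OF \<theta>] pos by simp
  define G where "G = inverse (sinh_symbol A) * inverse (cosh_symbol B) * sinh_symbol (B - A)"
  define \<rho> where "\<rho> = sinh ((B - A) * y) / (sinh (A * y) * cosh (B * y))"
  have G: "kernel_bound q G \<rho>"
    unfolding G_def \<rho>_def using A_pos AB y' q by (intro kernel_bound_iteration_kernel) auto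
  let ?W = "\<lambda>k. L2_set (\<lambda>n. q ^ n * h k n) {1..N}"
  have \<rho>0: "\<rho> \<ge> 0"
    unfolding \<rho>_def using A_pos AB y' by (auto intro!: divide_nonneg_nonneg mult_nonneg_nonneg
        simp: cosh_real_nonneg)
  have M0: "M \<ge> 0"
  proof -
    have "0 \<le> (1 - \<theta>) * \<rho>"
      using \<theta>1 \<rho>0 by (rule mult_nonneg_nonneg)
    also have "\<dots> \<le> M"
      unfolding \<rho>_def by (rule M)
    finally show ?thesis .
  qed
  have step: "?W (Suc k) \<le> M * ?W k" for k
  proof -
    define H where "H = Abs_fps (\<lambda>n. if n = 0 then 0 else h k n)"
    have H: "H $ 0 = 0" "\<And>n. n \<in> {1..N} \<Longrightarrow> H $ n = h k n"
      by (auto simp: H_def)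
    have "?W (Suc k) = L2_set (\<lambda>n. \<bar>q ^ n * h (Suc k) n\<bar>) {1..N}"
      by (simp add: L2_set_def)
    also have "\<dots> = L2_set (\<lambda>n. (1 - \<theta>) * \<bar>q ^ n * (G * H) $ n\<bar>) {1..N}"
      using \<theta>1
      by (intro L2_set_cong refl, subst dnwr_error_iteration_kernel[OF pos \<theta> iter A B H_def])
        (auto simp: G_def abs_mult mult_ac)
    also have "\<dots> = (1 - \<theta>) * L2_set (\<lambda>n. \<bar>q ^ n * (G * H) $ n\<bar>) {1..N}"
      using \<theta>1 by (simp add: L2_set_right_distrib)
    also have "L2_set (\<lambda>n. \<bar>q ^ n * (G * H) $ n\<bar>) {1..N} = L2_set (\<lambda>n. q ^ n * (G * H) $ n) {1..N}"
      by (simp add: L2_set_def)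
    also have "\<dots> \<le> \<rho> * L2_set (\<lambda>n. q ^ n * H $ n) {1..N}"
      using q by (intro weighted_L2_convolution_le[OF G _ H(1)]) auto
    also have "L2_set (\<lambda>n. q ^ n * H $ n) {1..N} = ?W k"
      by (intro L2_set_cong refl) (simp add: H)
    finally have "?W (Suc k) \<le> (1 - \<theta>) * \<rho> * ?W k"
      using \<theta>1 by (simp add: mult_left_mono mult.assoc)
    also have "\<dots> \<le> M * ?W k"
      using M by (intro mult_right_mono) (simp_all add: \<rho>_def)
    finally show ?thesis .
  qed
  have W: "?W k \<le> M ^ k * ?W 0" for k
  proof (induction k)
    case (Suc k)
    have "?W (Suc k) \<le> M * ?W k"
      by (rule step)
    also have "\<dots> \<le> M * (M ^ k * ?W 0)"
      using Suc M0 by (rule mult_left_mono)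
    finally show ?case
      by (simp add: mult.assoc)
  qed simp
  have "q ^ N * L2_set (h k) {1..N} = L2_set (\<lambda>n. q ^ N * \<bar>h k n\<bar>) {1..N}"
    using q by (subst L2_set_right_distrib) (simp_all add: L2_set_def power_mult_distrib)
  also have "\<dots> \<le> L2_set (\<lambda>n. q ^ n * \<bar>h k n\<bar>) {1..N}"
    using q by (intro L2_set_mono mult_right_mono power_decreasing) auto
  also have "\<dots> = ?W k"
    by (simp add: L2_set_def power_mult_distrib)
  also have "\<dots> \<le> M ^ k * ?W 0"
    by (rule W)
  also have "?W 0 = L2_set (\<lambda>n. q ^ n * \<bar>h 0 n\<bar>) {1..N}"
    by (simp add: L2_set_def power_mult_distrib)
  also have "\<dots> \<le> L2_set (\<lambda>n. \<bar>h 0 n\<bar>) {1..N}"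
    using q by (intro L2_set_mono mult_left_le_one_le power_le_one) auto
  also have "\<dots> = L2_set (h 0) {1..N}"
    by (simp add: L2_set_def)
  finally have le: "q ^ N * L2_set (h k) {1..N} \<le> M ^ k * L2_set (h 0) {1..N}"
    using M0 by (simp add: mult_left_mono)
  have "exp (r * (real N * dt)) * q ^ N = 1"
    by (simp add: q_def algebra_simps flip: exp_of_nat_mult exp_add)
  then have "L2_set (h k) {1..N} = exp (r * (real N * dt)) * (q ^ N * L2_set (h k) {1..N})"
    unfolding mult.assoc[symmetric] by simp
  also have "\<dots> \<le> exp (r * (real N * dt)) * (M ^ k * L2_set (h 0) {1..N})"
    by (rule mult_left_mono[OF le]) simp
  finally show ?thesis
    by (simp add: mult_ac)
qed

theorem theorem6:
  fixes a b T \<alpha>\<^sub>1 \<alpha>\<^sub>2 lam\<^sub>1 lam\<^sub>2 dt \<theta> :: real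
    and N :: nat
    and u\<^sub>1 u\<^sub>2 :: "nat \<Rightarrow> nat \<Rightarrow> real \<Rightarrow> real"
    and h :: "nat \<Rightarrow> nat \<Rightarrow> real"
  assumes "a > 0" and "b > 0" and "T > 0"
    and "\<alpha>\<^sub>1 > 0" and "\<alpha>\<^sub>2 > 0" and "lam\<^sub>1 > 0" and "lam\<^sub>2 > 0"
    and "N \<ge> 1"
    and "dt = T / real N"
    and "\<theta> = sqrt (\<alpha>\<^sub>2 * lam\<^sub>2) / (sqrt (\<alpha>\<^sub>1 * lam\<^sub>1) + sqrt (\<alpha>\<^sub>2 * lam\<^sub>2))"
    and "dnwr_error_iteration a b \<alpha>\<^sub>1 \<alpha>\<^sub>2 lam\<^sub>1 lam\<^sub>2 dt N \<theta> u\<^sub>1 u\<^sub>2 h"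
  shows "(sqrt (\<alpha>\<^sub>1 / lam\<^sub>1) * a < sqrt (\<alpha>\<^sub>2 / lam\<^sub>2) * b \<and>
          sqrt (\<alpha>\<^sub>2 / lam\<^sub>2) * b < 2 * sqrt (\<alpha>\<^sub>1 / lam\<^sub>1) * a \<longrightarrow>
          (\<forall>k\<ge>1. L2_set (h k) {1..N} \<le>
             (2 * ((sqrt (\<alpha>\<^sub>2 * lam\<^sub>1 / (\<alpha>\<^sub>1 * lam\<^sub>2)) * (b / a) - 1) /
                   (sqrt (\<alpha>\<^sub>2 * lam\<^sub>2 / (\<alpha>\<^sub>1 * lam\<^sub>1)) + 1))) ^ k
             * phi1 b T \<alpha>\<^sub>2 lam\<^sub>2 dt k (r1d b T \<alpha>\<^sub>2 lam\<^sub>2 dt k) * L2_set (h 0) {1..N})) \<and>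
         (sqrt (\<alpha>\<^sub>2 / lam\<^sub>2) * b \<ge> 2 * sqrt (\<alpha>\<^sub>1 / lam\<^sub>1) * a \<longrightarrow>
          (\<forall>k\<ge>1. L2_set (h k) {1..N} \<le>
             (2 * ((sqrt (\<alpha>\<^sub>2 * lam\<^sub>1 / (\<alpha>\<^sub>1 * lam\<^sub>2)) * (b / a) - 1) /
                   (sqrt (\<alpha>\<^sub>2 * lam\<^sub>2 / (\<alpha>\<^sub>1 * lam\<^sub>1)) + 1))) ^ k
             * phi2 a T \<alpha>\<^sub>1 lam\<^sub>1 dt k (r2d a T \<alpha>\<^sub>1 lam\<^sub>1 dt k) * L2_set (h 0) {1..N}))"
proof -
  have dt: "dt > 0" "real N * dt = T"
    using assms by simp_all
  define A B where "A = sqrt (\<alpha>\<^sub>1 / (lam\<^sub>1 * dt)) * a" and "B = sqrt (\<alpha>\<^sub>2 / (lam\<^sub>2 * dt)) * b"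
  let ?p = "sqrt (\<alpha>\<^sub>1 / lam\<^sub>1) * a" and ?q = "sqrt (\<alpha>\<^sub>2 / lam\<^sub>2) * b"
  have AB: "A = ?p / sqrt dt" "B = ?q / sqrt dt"
    using assms(6,7) dt by (simp_all add: A_def B_def real_sqrt_mult real_sqrt_divide)
  have A_pos: "A > 0"
    using assms dt by (simp add: A_def)
  let ?R = "B / A - 1"
  define C where "C = 2 * ((sqrt (\<alpha>\<^sub>2 * lam\<^sub>1 / (\<alpha>\<^sub>1 * lam\<^sub>2)) * (b / a) - 1) /
                   (sqrt (\<alpha>\<^sub>2 * lam\<^sub>2 / (\<alpha>\<^sub>1 * lam\<^sub>1)) + 1))"
  have C: "C = (1 - \<theta>) * (2 * ?R)"
  proof -
    define s\<^sub>1 s\<^sub>2 where "s\<^sub>1 = sqrt (\<alpha>\<^sub>1 * lam\<^sub>1)" and "s\<^sub>2 = sqrt (\<alpha>\<^sub>2 * lam\<^sub>2)"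
    have s: "s\<^sub>1 > 0" "s\<^sub>2 > 0"
      using assms by (simp_all add: s\<^sub>1_def s\<^sub>2_def)
    have "sqrt (\<alpha>\<^sub>2 * lam\<^sub>1 / (\<alpha>\<^sub>1 * lam\<^sub>2)) * (b / a) = B / A"
      using assms(1-7) dt by (simp add: AB real_sqrt_mult real_sqrt_divide field_simps)
    moreover have "1 / (sqrt (\<alpha>\<^sub>2 * lam\<^sub>2 / (\<alpha>\<^sub>1 * lam\<^sub>1)) + 1) = 1 - \<theta>"
      unfolding assms(10) real_sqrt_divide s\<^sub>1_def[symmetric] s\<^sub>2_def[symmetric]
      using s by (simp add: field_simps)
    moreover have "2 * (x / z) = (1 / z) * (2 * x)" for x z :: real
      by simp
    ultimately show ?thesis
      unfolding C_def by metis
  qed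
  have \<theta>1: "1 - \<theta> \<ge> 0"
    using relaxation_le_1[OF assms(10)] assms by simp
  \<comment> \<open>Both cases are instances: \<open>c\<close> is \<open>B * sqrt dt\<close> in the first and
      \<open>2 * A * sqrt dt\<close> in the second, a length scaled by
      \<open>sqrt (\<alpha> / lam)\<close>.\<close>
  have bound: "L2_set (h k) {1..N} \<le>
      C ^ k * exp (r * T - real k * c * sqrt ((1 - exp (- r * dt)) / dt)) * L2_set (h 0) {1..N}"
    if r: "r > 0" and "A \<le> B"
      and factor: "\<And>y. y > 0 \<Longrightarrow>
        sinh ((B - A) * y) / (sinh (A * y) * cosh (B * y)) \<le> 2 * ?R * exp (- (c / sqrt dt) * y)"
    for r c k
  proof -
    define y where "y = sqrt (1 - exp (- r * dt))"
    have y: "y > 0"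
      using r dt by (simp add: y_def)
    have "(1 - \<theta>) * (sinh ((B - A) * y) / (sinh (A * y) * cosh (B * y))) \<le>
        (1 - \<theta>) * (2 * ?R * exp (- (c / sqrt dt) * y))"
      by (intro mult_left_mono factor y \<theta>1)
    also have "\<dots> = C * exp (- (c / sqrt dt) * y)"
      by (simp add: C)
    finally have "L2_set (h k) {1..N} \<le>
        (C * exp (- (c / sqrt dt) * y)) ^ k * exp (r * (real N * dt)) * L2_set (h 0) {1..N}"
      using dnwr_error_contraction[OF assms(1,2,4-7) dt(1) assms(10,11) A_def B_def
          \<open>A \<le> B\<close> r _ y_def] by blast
    also have "(C * exp (- (c / sqrt dt) * y)) ^ k * exp (r * (real N * dt)) =
        C ^ k * exp (r * T - real k * c * sqrt ((1 - exp (- r * dt)) / dt))"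
      unfolding dt(2) by (simp add: power_mult_distrib y_def real_sqrt_divide mult_ac
          flip: exp_of_nat_mult exp_add)
    finally show ?thesis .
  qed
  \<comment> \<open>For \<open>k \<ge> 1\<close> the logarithms are positive, so \<open>r1d\<close> and
      \<open>r2d\<close> are admissible choices of \<open>r\<close>.\<close>
  have r_pos: "1 / dt * ln ((1 + sqrt (x + 1)) / 2) > 0" if "x > 0" for x
    using that dt by (intro mult_pos_pos ln_gt_zero) simp_all
  show ?thesis
    unfolding C_def[symmetric]
  proof (intro conjI impI allI)
    fix k :: nat
    assume *: "?p < ?q \<and> ?q < 2 * sqrt (\<alpha>\<^sub>1 / lam\<^sub>1) * a" and k: "k \<ge> 1"
    have le: "A \<le> B" "B \<le> 2 * A"
      using * dt unfolding AB by (auto simp: field_simps)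
    have r: "r1d b T \<alpha>\<^sub>2 lam\<^sub>2 dt k > 0"
      unfolding r1d_def using assms(1-7) dt k by (intro r_pos) simp
    have "L2_set (h k) {1..N} \<le> C ^ k * exp (r1d b T \<alpha>\<^sub>2 lam\<^sub>2 dt k * T -
        real k * ?q * sqrt ((1 - exp (- r1d b T \<alpha>\<^sub>2 lam\<^sub>2 dt k * dt)) / dt)) * L2_set (h 0) {1..N}"
      using iteration_factor_le_near[OF _ A_pos le] by (intro bound r le) (simp add: AB(2))
    then show "L2_set (h k) {1..N} \<le>
        C ^ k * phi1 b T \<alpha>\<^sub>2 lam\<^sub>2 dt k (r1d b T \<alpha>\<^sub>2 lam\<^sub>2 dt k) * L2_set (h 0) {1..N}"
      by (simp add: phi1_def mult_ac)
  next
    fix k :: nat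
    assume *: "2 * sqrt (\<alpha>\<^sub>1 / lam\<^sub>1) * a \<le> ?q" and k: "k \<ge> 1"
    have far: "2 * A \<le> B"
      using * dt unfolding AB by (auto simp: field_simps)
    have r: "r2d a T \<alpha>\<^sub>1 lam\<^sub>1 dt k > 0"
      unfolding r2d_def using assms(1-7) dt k by (intro r_pos) simp
    have "L2_set (h k) {1..N} \<le> C ^ k * exp (r2d a T \<alpha>\<^sub>1 lam\<^sub>1 dt k * T -
        real k * (2 * ?p) * sqrt ((1 - exp (- r2d a T \<alpha>\<^sub>1 lam\<^sub>1 dt k * dt)) / dt)) * L2_set (h 0) {1..N}"
    proof (intro bound r)
      show "A \<le> B"
        using far A_pos by simp
      show "sinh ((B - A) * y) / (sinh (A * y) * cosh (B * y)) \<le>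
          2 * ?R * exp (- (2 * ?p / sqrt dt) * y)" if "y > 0" for y
        using iteration_factor_le_far[OF that A_pos far] by (simp add: AB(1))
    qed
    then show "L2_set (h k) {1..N} \<le>
        C ^ k * phi2 a T \<alpha>\<^sub>1 lam\<^sub>1 dt k (r2d a T \<alpha>\<^sub>1 lam\<^sub>1 dt k) * L2_set (h 0) {1..N}"
      by (simp add: phi2_def mult_ac)
  qed
qed

end
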